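(* Let $e>0$ be fixed, let $f:\mathbb{R}\to\mathbb{R}$ be a continuous function satisfying (f1) $\lim_{|s|\to\infty} f(s)/s=0$; (f2) $\lim_{s\to 0} f(s)/s=0$; (f3) there exists $s_0\in\mathbb{R}$ with $F(s_0)>0$, where $F(s)=\int_0^s f(t)\,dt$, and let $\alpha\in L^\infty(\mathbb{R}^3)$. Define $$c_f=\max_{s\neq 0}\frac{|f(s)|}{|s|+4\sqrt{\pi}\,e\,s^2}>0.$$ Then for every $\lambda\in[0,\|\alpha\|_\infty^{-1}c_f^{-1})$ (with the convention $1/0=+\infty$), the only weak solution $(u,\phi)\in H^1(\mathbb{R}^3)\times\mathcal D^{1,2}(\mathbb{R}^3)$ of the system $$-\Delta u+u+e\phi u=\lambda\alpha(x)f(u)\ \text{in }\mathbb{R}^3,\qquad -\Delta\phi=4\pi e u^2\ \text{in }\mathbb{R}^3$$ is $(u,\phi)=(0,0)$.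
   Context: $H^1(\mathbb{R}^3)$ is the standard Sobolev space with norm $\|u\|_{H^1}=(\int_{\mathbb{R}^3}|\nabla u|^2+u^2)^{1/2}$. $\mathcal D^{1,2}(\mathbb{R}^3)$ is the completion of $C_0^\infty(\mathbb{R}^3)$ with respect to the norm $\|\phi\|_{\mathcal D^{1,2}}=(\int_{\mathbb{R}^3}|\nabla\phi|^2)^{1/2}$. A weak solution is a pair $(u,\phi)\in H^1(\mathbb{R}^3)\times\mathcal D^{1,2}(\mathbb{R}^3)$ such that $\int_{\mathbb{R}^3}(\nabla u\cdot\nabla v+uv+e\phi uv)=\lambda\int_{\mathbb{R}^3}\alpha(x)f(u)v$ for all $v\in H^1(\mathbb{R}^3)$ and $\int_{\mathbb{R}^3}\nabla\phi\cdot\nabla\psi=4\pi e\int_{\mathbb{R}^3}u^2\psi$ for all $\psi\in\mathcal D^{1,2}(\mathbb{R}^3)$. *)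

theory Defs
  imports "HOL-Analysis.Analysis" "HOL-Probability.Essential_Supremum"
begin

type_synonym R3 = "real ^ 3"

definition partial :: "3 \<Rightarrow> (R3 \<Rightarrow> real) \<Rightarrow> R3 \<Rightarrow> real" where
  "partial i g x = frechet_derivative g (at x) (axis i 1)"

definition grad :: "(R3 \<Rightarrow> real) \<Rightarrow> R3 \<Rightarrow> R3" where
  "grad g x = (\<chi> i. partial i g x)"

definition smooth3 :: "(R3 \<Rightarrow> real) \<Rightarrow> bool" where
  "smooth3 g \<longleftrightarrow> (\<forall>is :: 3 list. \<forall>x. foldr partial is g differentiable (at x))"

definition test_fun :: "(R3 \<Rightarrow> real) \<Rightarrow> bool" where
  "test_fun g \<longleftrightarrow> smooth3 g \<and> compact (closure {x. g x \<noteq> 0})"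

definition L2 :: "(R3 \<Rightarrow> real) \<Rightarrow> bool" where
  "L2 u \<longleftrightarrow> u \<in> borel_measurable lborel \<and> integrable lborel (\<lambda>x. (u x)\<^sup>2)"

definition L2vec :: "(R3 \<Rightarrow> R3) \<Rightarrow> bool" where
  "L2vec G \<longleftrightarrow> G \<in> borel_measurable lborel \<and> integrable lborel (\<lambda>x. (norm (G x))\<^sup>2)"

definition weak_grad :: "(R3 \<Rightarrow> real) \<Rightarrow> (R3 \<Rightarrow> R3) \<Rightarrow> bool" where
  "weak_grad u G \<longleftrightarrow>
     u \<in> borel_measurable lborel \<and> G \<in> borel_measurable lborel \<and>
     (\<forall>K. compact K \<longrightarrow> set_integrable lborel K u \<and> (\<forall>i. set_integrable lborel K (\<lambda>x. G x $ i))) \<and>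
     (\<forall>\<psi>. test_fun \<psi> \<longrightarrow> (\<forall>i.
        (\<integral>x. u x * partial i \<psi> x \<partial>lborel) = - (\<integral>x. G x $ i * \<psi> x \<partial>lborel)))"

definition H1_grad :: "(R3 \<Rightarrow> real) \<Rightarrow> (R3 \<Rightarrow> R3) \<Rightarrow> bool" where
  "H1_grad u G \<longleftrightarrow> L2 u \<and> weak_grad u G \<and> L2vec G"

text \<open>phi \<in> D^{1,2}(R^3) (completion of C_0^infinity w.r.t. the gradient L^2 norm) with weak
  gradient G: phi is the a.e. limit of test functions whose gradients converge to G in L^2.\<close>
definition D12_grad :: "(R3 \<Rightarrow> real) \<Rightarrow> (R3 \<Rightarrow> R3) \<Rightarrow> bool" where
  "D12_grad \<phi> G \<longleftrightarrow> weak_grad \<phi> G \<and> L2vec G \<and>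
     (\<exists>\<psi>s :: nat \<Rightarrow> R3 \<Rightarrow> real. (\<forall>n. test_fun (\<psi>s n)) \<and>
        (AE x in lborel. (\<lambda>n. \<psi>s n x) \<longlonglongrightarrow> \<phi> x) \<and>
        (\<lambda>n. \<integral>x. (norm (grad (\<psi>s n) x - G x))\<^sup>2 \<partial>lborel) \<longlonglongrightarrow> 0)"

definition weak_solution ::
  "real \<Rightarrow> real \<Rightarrow> (R3 \<Rightarrow> real) \<Rightarrow> (real \<Rightarrow> real) \<Rightarrow> (R3 \<Rightarrow> real) \<Rightarrow> (R3 \<Rightarrow> real) \<Rightarrow> bool" where
  "weak_solution e lam \<alpha> f u \<phi> \<longleftrightarrow>
     (\<exists>Gu G\<phi>. H1_grad u Gu \<and> D12_grad \<phi> G\<phi> \<and>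
       (\<forall>v Gv. H1_grad v Gv \<longrightarrow>
          (\<integral>x. Gu x \<bullet> Gv x + u x * v x + e * \<phi> x * u x * v x \<partial>lborel)
            = lam * (\<integral>x. \<alpha> x * f (u x) * v x \<partial>lborel)) \<and>
       (\<forall>\<psi> G\<psi>. D12_grad \<psi> G\<psi> \<longrightarrow>
          (\<integral>x. G\<phi> x \<bullet> G\<psi> x \<partial>lborel) = 4 * pi * e * (\<integral>x. (u x)\<^sup>2 * \<psi> x \<partial>lborel)))"

definition Linf :: "(R3 \<Rightarrow> real) \<Rightarrow> bool" where
  "Linf \<alpha> \<longleftrightarrow> \<alpha> \<in> borel_measurable lborel \<and> esssup lborel (\<lambda>x. ereal \<bar>\<alpha> x\<bar>) < \<infinity>"

definition norm_inf :: "(R3 \<Rightarrow> real) \<Rightarrow> real" where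
  "norm_inf \<alpha> = real_of_ereal (esssup lborel (\<lambda>x. ereal \<bar>\<alpha> x\<bar>))"

definition c_f :: "real \<Rightarrow> (real \<Rightarrow> real) \<Rightarrow> real" where
  "c_f e f = Sup ((\<lambda>s. \<bar>f s\<bar> / (\<bar>s\<bar> + 4 * sqrt pi * e * s\<^sup>2)) ` (UNIV - {0}))"

end

theory Submission
  imports Defs
begin

text \<open>
  Write \<open>I, J, K, Q\<close> for the integrals of \<open>\<bar>\<nabla>u\<bar>\<^sup>2, u\<^sup>2, \<bar>\<nabla>\<phi>\<bar>\<^sup>2, \<bar>u\<bar>\<^sup>3\<close>. Testing the first equation with
  \<open>u\<close> and the second with \<open>\<phi>\<close> gives \<open>I + J + K / (4\<pi>) = \<lambda> \<integral> \<alpha> f(u) u\<close>, and the right-hand side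
  is at most \<open>\<lambda> \<parallel>\<alpha>\<parallel>\<^sub>\<infinity> c\<^sub>f (J + 4 \<surd>\<pi> e Q)\<close>. Testing the second equation with \<open>\<bar>u\<bar>\<close> and applying
  \<open>a b \<le> a\<^sup>2 + b\<^sup>2 / 4\<close> gives \<open>4 \<surd>\<pi> e Q \<le> I + K / (4\<pi>)\<close>. Since
  \<open>\<lambda> \<parallel>\<alpha>\<parallel>\<^sub>\<infinity> c\<^sub>f < 1\<close>, all these integrals vanish.

  Instead of \<open>\<bar>u\<bar>\<close> itself, the second equation is tested with smoothed absolute values of
  mollified cut-offs of \<open>u\<close>; Fatou's lemma then gives the bound on \<open>Q\<close>. That \<open>\<nabla>\<phi> = 0\<close> forces
  \<open>\<phi> = 0\<close> follows from a weighted Hardy inequality for test functions.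
\<close>

section \<open>Integration in Euclidean space\<close>

lemma integral_Fatou:
  fixes f :: "nat \<Rightarrow> 'a \<Rightarrow> real"
  assumes f: "\<And>n. integrable M (f n)" "\<And>n. AE x in M. 0 \<le> f n x"
    and [measurable]: "g \<in> borel_measurable M"
    and lim: "AE x in M. (\<lambda>n. f n x) \<longlonglongrightarrow> g x"
    and le: "\<And>n. (\<integral>x. f n x \<partial>M) \<le> B n" "B \<longlonglongrightarrow> L"
  shows "integrable M g" and "(\<integral>x. g x \<partial>M) \<le> L"
proof -
  have [measurable]: "f n \<in> borel_measurable M" for n
    using f(1) by (rule borel_measurable_integrable)
  have "AE x in M. \<forall>n. 0 \<le> f n x"
    using f(2) by (simp add: AE_all_countable)
  with lim have pos: "AE x in M. 0 \<le> g x"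
    by eventually_elim (auto intro: LIMSEQ_le_const)
  have "0 \<le> B n" for n
    using le(1)[of n] integral_nonneg_AE[OF f(2)] by (rule order_trans[rotated])
  then have L: "0 \<le> L"
    using le(2) by (auto intro: LIMSEQ_le_const)
  have "(\<integral>\<^sup>+x. ennreal (g x) \<partial>M) = (\<integral>\<^sup>+x. liminf (\<lambda>n. ennreal (f n x)) \<partial>M)"
    using lim by (intro nn_integral_cong_AE)
      (auto intro!: lim_imp_Liminf[symmetric] tendsto_ennrealI elim: eventually_mono)
  also have "\<dots> \<le> liminf (\<lambda>n. \<integral>\<^sup>+x. ennreal (f n x) \<partial>M)"
    by (rule nn_integral_liminf) measurable
  also have "\<dots> \<le> liminf (\<lambda>n. ennreal (B n))"
    using f le(1) by (intro Liminf_mono always_eventually allI) (simp add: nn_integral_eq_integral ennreal_leI)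
  also have "\<dots> = ennreal L"
    using le(2) by (intro lim_imp_Liminf tendsto_ennrealI) auto
  finally have bound: "(\<integral>\<^sup>+x. ennreal (g x) \<partial>M) \<le> ennreal L" .
  then show int: "integrable M g"
    using pos by (intro integrableI_nonneg) (auto intro: le_less_trans)
  show "(\<integral>x. g x \<partial>M) \<le> L"
    using bound L nn_integral_eq_integral[OF int pos] by simp
qed

lemma dominated_convergence_at:
  fixes q :: "'a::metric_space \<Rightarrow> 'b \<Rightarrow> real"
  assumes q: "\<And>z. q z \<in> borel_measurable M" "\<And>y. ((\<lambda>z. q z y) \<longlongrightarrow> l y) (at x)"
    and l: "l \<in> borel_measurable M"
    and w: "integrable M w" "\<And>z y. z \<noteq> x \<Longrightarrow> \<bar>q z y\<bar> \<le> w y"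
  shows "((\<lambda>z. \<integral>y. q z y \<partial>M) \<longlongrightarrow> (\<integral>y. l y \<partial>M)) (at x)"
  unfolding tendsto_at_iff_sequentially
proof (intro allI impI)
  fix X assume X: "\<forall>i. X i \<in> UNIV - {x}" "X \<longlonglongrightarrow> x"
  have "(\<lambda>n. \<integral>y. q (X n) y \<partial>M) \<longlonglongrightarrow> (\<integral>y. l y \<partial>M)"
  proof (rule integral_dominated_convergence[OF l q(1) w(1)])
    show "AE y in M. (\<lambda>n. q (X n) y) \<longlonglongrightarrow> l y"
      using q(2) X by (auto simp: tendsto_at_iff_sequentially o_def)
    show "AE y in M. norm (q (X n) y) \<le> w y" for n
      using w(2) X(1) by auto
  qed
  then show "((\<lambda>z. \<integral>y. q z y \<partial>M) \<circ> X) \<longlonglongrightarrow> (\<integral>y. l y \<partial>M)"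
    by (simp add: o_def)
qed

lemma has_derivative_integral:
  fixes F :: "'a::euclidean_space \<Rightarrow> 'b \<Rightarrow> real" and G :: "'a \<Rightarrow> 'b \<Rightarrow> 'a"
  assumes F: "\<And>x. integrable M (F x)"
    and deriv: "\<And>x y. ((\<lambda>x. F x y) has_derivative (\<lambda>h. G x y \<bullet> h)) (at x)"
    and G [measurable]: "G x \<in> borel_measurable M"
    and w: "integrable M w" "\<And>x y. norm (G x y) \<le> w y"
  shows "((\<lambda>x. \<integral>y. F x y \<partial>M) has_derivative (\<lambda>h. (\<integral>y. G x y \<partial>M) \<bullet> h)) (at x)"
proof -
  have intG: "integrable M (G x)"
    using w(1) G by (rule Bochner_Integration.integrable_bound) (use order_trans[OF w(2) abs_ge_self] in auto)
  define q where "q z y = (F z y - F x y - G x y \<bullet> (z - x)) / norm (z - x)" for z y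
  have q_integral: "integrable M (q z)"
    "(\<integral>y. q z y \<partial>M) = ((\<integral>y. F z y \<partial>M) - (\<integral>y. F x y \<partial>M) - (\<integral>y. G x y \<partial>M) \<bullet> (z - x)) / norm (z - x)" for z
    using F intG by (simp_all add: q_def[abs_def])
  have q_bound: "\<bar>q z y\<bar> \<le> 2 * w y" if "z \<noteq> x" for z y
  proof -
    have inner_le: "\<bar>G a y \<bullet> h\<bar> \<le> w y * norm h" for a h
      using Cauchy_Schwarz_ineq2[of "G a y" h] mult_right_mono[OF w(2) norm_ge_zero] by (rule order_trans)
    have "norm (F z y - F x y) \<le> w y * norm (z - x)"
      by (rule differentiable_bound[where S = UNIV and f' = "\<lambda>a h. G a y \<bullet> h"])
         (auto intro!: onorm_le deriv inner_le)
    with inner_le[of x "z - x"] have "\<bar>F z y - F x y - G x y \<bullet> (z - x)\<bar> \<le> 2 * w y * norm (z - x)"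
      by simp
    with that show ?thesis by (simp add: q_def field_simps)
  qed
  have q_tendsto: "((\<lambda>z. q z y) \<longlongrightarrow> 0) (at x)" for y
  proof (rule tendsto_norm_zero_cancel)
    have "norm (q z y) = norm (F z y - F x y - G x y \<bullet> (z - x)) / norm (z - x)" for z
      by (simp add: q_def)
    with deriv[where x = x and y = y] show "((\<lambda>z. norm (q z y)) \<longlongrightarrow> 0) (at x)"
      unfolding has_derivative_iff_norm by simp
  qed
  have "((\<lambda>z. \<integral>y. q z y \<partial>M) \<longlongrightarrow> (\<integral>y. 0 \<partial>M)) (at x)"
    using w(1) q_integral(1) q_bound q_tendsto by (intro dominated_convergence_at[where w = "\<lambda>y. 2 * w y"]) auto
  then show ?thesis
    unfolding has_derivative_iff_norm q_integral(2)
    by (auto intro: bounded_linear_inner_right dest: tendsto_norm_zero)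
qed

lemma
  fixes f :: "'a::euclidean_space \<Rightarrow> real" and a :: 'a and s :: real
  assumes [measurable]: "f \<in> borel_measurable borel" and s: "\<bar>s\<bar> = 1"
  shows integral_affine_unit: "(\<integral>x. f (a + s *\<^sub>R x) \<partial>lborel) = (\<integral>x. f x \<partial>lborel)"
    and integrable_affine_unit: "integrable lborel (\<lambda>x. f (a + s *\<^sub>R x)) \<longleftrightarrow> integrable lborel f"
proof -
  have distr: "distr lborel borel (\<lambda>x. a + s *\<^sub>R x) = lborel"
    using lborel_affine[of s a] s by (auto simp: density_1)
  have "(\<integral>x. f x \<partial>distr lborel borel (\<lambda>x. a + s *\<^sub>R x)) = (\<integral>x. f (a + s *\<^sub>R x) \<partial>lborel)"
    by (rule integral_distr) auto
  then show "(\<integral>x. f (a + s *\<^sub>R x) \<partial>lborel) = (\<integral>x. f x \<partial>lborel)"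
    by (simp add: distr)
  have "integrable (distr lborel borel (\<lambda>x. a + s *\<^sub>R x)) f \<longleftrightarrow> integrable lborel (\<lambda>x. f (a + s *\<^sub>R x))"
    by (rule integrable_distr_eq) auto
  then show "integrable lborel (\<lambda>x. f (a + s *\<^sub>R x)) \<longleftrightarrow> integrable lborel f"
    by (simp add: distr)
qed

lemma integrable_bounded_mult:
  fixes v g :: "'a \<Rightarrow> real"
  assumes v: "integrable M v" and g: "g \<in> borel_measurable M" "\<And>x. \<bar>g x\<bar> \<le> B"
  shows "integrable M (\<lambda>x. g x * v x)"
proof (rule Bochner_Integration.integrable_bound)
  show "integrable M (\<lambda>x. B * v x)" using v by simp
  show "AE x in M. norm (g x * v x) \<le> norm (B * v x)"
    using order_trans[OF g(2) abs_ge_self[of B]] by (auto simp: abs_mult intro!: mult_right_mono)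
qed (use v g(1) in auto)

lemma integrable_indicator_cball:
  "integrable lborel (indicator (cball a r) :: 'a::euclidean_space \<Rightarrow> real)"
  using emeasure_bounded_finite[OF bounded_cball] by (intro integrable_real_indicator) auto

definition locally_integrable :: "('a::euclidean_space \<Rightarrow> real) \<Rightarrow> bool" where
  "locally_integrable u \<longleftrightarrow> (\<forall>K. compact K \<longrightarrow> set_integrable lborel K u)"

lemma integrable_imp_locally_integrable: "integrable lborel u \<Longrightarrow> locally_integrable u"
  unfolding locally_integrable_def set_integrable_def
  by (intro allI impI integrable_mult_indicator) (auto intro: borel_compact)

lemma locally_integrable_continuous: "continuous_on UNIV u \<Longrightarrow> locally_integrable u"
  unfolding locally_integrable_def set_integrable_def
  by (intro allI impI borel_integrable_compact) (auto intro: continuous_on_subset)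

lemma locally_integrable_add:
  "locally_integrable u \<Longrightarrow> locally_integrable v \<Longrightarrow> locally_integrable (\<lambda>x. u x + v x)"
  unfolding locally_integrable_def by (auto intro: set_integral_add)

lemma locally_integrable_mult_continuous:
  assumes \<kappa>: "continuous_on UNIV \<kappa>" and u: "locally_integrable u"
  shows "locally_integrable (\<lambda>x. \<kappa> x * u x)"
  unfolding locally_integrable_def set_integrable_def
proof (intro allI impI)
  fix K :: "'a set" assume K: "compact K"
  then have "compact (\<kappa> ` K)"
    by (intro compact_continuous_image continuous_on_subset[OF \<kappa>]) auto
  then have "bounded (\<kappa> ` K)"
    by (rule compact_imp_bounded)
  then obtain B where B: "\<And>x. x \<in> K \<Longrightarrow> \<bar>\<kappa> x\<bar> \<le> B"
    by (auto simp: bounded_iff)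
  have "integrable lborel (\<lambda>x. (indicator K x * \<kappa> x) * (indicator K x *\<^sub>R u x))"
  proof (rule integrable_bounded_mult[where B = "\<bar>B\<bar>"])
    show "integrable lborel (\<lambda>x. indicator K x *\<^sub>R u x)"
      using u K by (simp add: locally_integrable_def set_integrable_def)
    show "(\<lambda>x. indicator K x * \<kappa> x) \<in> borel_measurable lborel"
      using \<kappa> borel_compact[OF K]
      by (intro borel_measurable_times) (auto intro: borel_measurable_continuous_onI)
    show "\<bar>indicator K x * \<kappa> x\<bar> \<le> \<bar>B\<bar>" for x
      using order_trans[OF B abs_ge_self] by (auto simp: indicator_def)
  qed
  then show "integrable lborel (\<lambda>x. indicator K x *\<^sub>R (\<kappa> x * u x))"
    by (rule back_subst[where P = "integrable lborel"]) (auto simp: indicator_def)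
qed

lemma locally_integrable_bounded_support:
  assumes "locally_integrable u" "bounded {x. u x \<noteq> 0}"
  shows "integrable lborel u"
proof -
  have "indicator (closure {x. u x \<noteq> 0}) x *\<^sub>R u x = u x" for x
    using closure_subset[of "{x. u x \<noteq> 0}"] by (auto simp: indicator_def)
  moreover have "integrable lborel (\<lambda>x. indicator (closure {x. u x \<noteq> 0}) x *\<^sub>R u x)"
    using assms by (simp add: locally_integrable_def set_integrable_def compact_closure)
  ultimately show ?thesis by (simp only:)
qed

definition Cc :: "('a::euclidean_space \<Rightarrow> real) \<Rightarrow> bool" where
  "Cc g \<longleftrightarrow> continuous_on UNIV g \<and> bounded {x. g x \<noteq> 0}"

lemma Cc_measurable: "Cc g \<Longrightarrow> g \<in> borel_measurable borel"
  by (simp add: Cc_def borel_measurable_continuous_onI)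

lemma Cc_integrable: "Cc g \<Longrightarrow> integrable lborel g"
  by (simp add: Cc_def locally_integrable_bounded_support locally_integrable_continuous)

lemma Cc_bounded:
  assumes "Cc g" obtains B where "\<And>x. \<bar>g x\<bar> \<le> B"
proof -
  have "compact (g ` closure {x. g x \<noteq> 0})"
    using assms unfolding Cc_def
    by (intro compact_continuous_image) (auto simp: compact_closure intro: continuous_on_subset)
  then have "bounded (g ` closure {x. g x \<noteq> 0})"
    by (rule compact_imp_bounded)
  then obtain B where B: "\<And>x. x \<in> closure {x. g x \<noteq> 0} \<Longrightarrow> \<bar>g x\<bar> \<le> B"
    by (auto simp: bounded_iff)
  have "\<bar>g x\<bar> \<le> max 0 B" for x
    using B[of x] closure_subset[of "{x. g x \<noteq> 0}"] by (cases "g x = 0") auto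
  then show ?thesis by (rule that)
qed

lemma Cc_mult_integrable:
  assumes "Cc g" "locally_integrable u" shows "integrable lborel (\<lambda>x. g x * u x)"
proof (rule locally_integrable_bounded_support)
  show "bounded {x. g x * u x \<noteq> 0}"
    by (rule bounded_subset[of "{x. g x \<noteq> 0}"]) (use assms(1) in \<open>auto simp: Cc_def\<close>)
qed (use assms in \<open>auto simp: Cc_def intro: locally_integrable_mult_continuous\<close>)

section \<open>Density of continuous functions in L1\<close>

lemma L1_dominated_convergence:
  fixes s :: "nat \<Rightarrow> 'a \<Rightarrow> real"
  assumes [measurable]: "\<And>n. s n \<in> borel_measurable M" "v \<in> borel_measurable M" and w: "integrable M w"
    and lim: "AE x in M. (\<lambda>n. s n x) \<longlonglongrightarrow> v x" and bound: "\<And>n. AE x in M. \<bar>s n x\<bar> \<le> w x"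
  shows "(\<lambda>n. \<integral>x. \<bar>s n x - v x\<bar> \<partial>M) \<longlonglongrightarrow> 0"
proof -
  have all_bound: "AE x in M. \<forall>n. \<bar>s n x\<bar> \<le> w x"
    using bound by (simp add: AE_all_countable)
  have "(\<lambda>n. \<integral>x. \<bar>s n x - v x\<bar> \<partial>M) \<longlonglongrightarrow> (\<integral>x. 0 \<partial>M)"
  proof (rule integral_dominated_convergence[where w = "\<lambda>x. 2 * w x"])
    show "AE x in M. (\<lambda>n. \<bar>s n x - v x\<bar>) \<longlonglongrightarrow> 0"
      using lim by eventually_elim (auto intro: tendsto_rabs_zero LIM_zero)
    show "AE x in M. norm \<bar>s n x - v x\<bar> \<le> 2 * w x" for n
      using lim all_bound
    proof eventually_elim
      case (elim x)
      then have "\<bar>v x\<bar> \<le> w x"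
        by (intro LIMSEQ_le_const2[OF tendsto_rabs]) auto
      moreover have "\<bar>s n x\<bar> \<le> w x"
        using elim(2) ..
      ultimately show ?case
        using abs_triangle_ineq4[of "s n x" "v x"] by simp
    qed
  qed (use w in auto)
  then show ?thesis by simp
qed

lemma AE_limit_of_continuous:
  fixes v :: "'a::euclidean_space \<Rightarrow> real"
  assumes v [measurable]: "v \<in> borel_measurable borel"
  obtains g where "\<And>n::nat. continuous_on UNIV (g n)" "AE x in lborel. (\<lambda>n. g n x) \<longlonglongrightarrow> v x"
proof -
  have "v \<in> borel_measurable lebesgue"
    by (intro measurable_completion) simp
  then have "v measurable_on UNIV"
    using measurable_on_iff_borel_measurable[of UNIV v] by simp
  then obtain N g where N: "negligible N" and g: "\<And>n::nat. continuous_on UNIV (g n)"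
    and lim: "\<And>x. x \<notin> N \<Longrightarrow> (\<lambda>n. g n x) \<longlonglongrightarrow> v x"
    unfolding measurable_on_def by auto
  have "AE x in lebesgue. x \<notin> N"
    using N by (simp add: negligible_iff_null_sets AE_not_in)
  then have "AE x in lborel. x \<notin> N"
    by (simp add: AE_completion_iff)
  then have "AE x in lborel. (\<lambda>n. g n x) \<longlonglongrightarrow> v x"
    by eventually_elim (rule lim)
  with g show ?thesis by (rule that)
qed

lemma Cc_L1_dense_bounded:
  fixes v :: "'a::euclidean_space \<Rightarrow> real"
  assumes v [measurable]: "v \<in> borel_measurable borel"
    and B: "0 \<le> B" "\<And>x. \<bar>v x\<bar> \<le> B" and R: "\<And>x. v x \<noteq> 0 \<Longrightarrow> norm x \<le> R" and \<epsilon>: "\<epsilon> > 0"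
  obtains k where "Cc k" "(\<integral>x. \<bar>k x - v x\<bar> \<partial>lborel) < \<epsilon>"
proof -
  obtain g where g: "\<And>n::nat. continuous_on UNIV (g n)" and lim: "AE x in lborel. (\<lambda>n. g n x) \<longlonglongrightarrow> v x"
    using AE_limit_of_continuous[OF v] by blast
  define c where "c x = max 0 (min 1 (R + 1 - norm x))" for x :: 'a
  define k where "k n x = c x * max (- B) (min B (g n x))" for n x
  have c_range: "0 \<le> c x" for x
    by (simp add: c_def)
  have c_continuous: "continuous_on UNIV c"
    unfolding c_def[abs_def] by (intro continuous_intros)
  have c_bounded: "bounded {x. c x \<noteq> 0}"
    by (rule bounded_subset[OF bounded_cball[of 0 "R + 1"]]) (auto simp: c_def max_def min_def split: if_splits)
  have k: "Cc (k n)" for n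
    unfolding Cc_def k_def[abs_def]
    by (intro conjI continuous_intros c_continuous g bounded_subset[OF c_bounded]) auto
  have "(\<lambda>n. \<integral>x. \<bar>k n x - v x\<bar> \<partial>lborel) \<longlonglongrightarrow> 0"
  proof (rule L1_dominated_convergence[where w = "\<lambda>x. B * c x"])
    show "integrable lborel (\<lambda>x. B * c x)"
      using c_continuous c_bounded by (intro integrable_mult_right Cc_integrable) (simp add: Cc_def)
    show "AE x in lborel. \<bar>k n x\<bar> \<le> B * c x" for n
      using c_range B(1) by (auto simp: k_def abs_mult mult.commute[of B] abs_le_iff intro!: mult_left_mono)
    show "AE x in lborel. (\<lambda>n. k n x) \<longlonglongrightarrow> v x"
      using lim
    proof eventually_elim
      case (elim x)
      then have "(\<lambda>n. k n x) \<longlonglongrightarrow> c x * max (- B) (min B (v x))"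
        unfolding k_def by (intro tendsto_intros)
      moreover have "c x * max (- B) (min B (v x)) = v x"
        using R[of x] B(2)[of x] by (cases "v x = 0") (auto simp: c_def)
      ultimately show ?case by simp
    qed
  qed (auto intro: Cc_measurable k)
  from order_tendstoD(2)[OF this \<epsilon>] obtain n where "(\<integral>x. \<bar>k n x - v x\<bar> \<partial>lborel) < \<epsilon>"
    by (auto simp: eventually_sequentially)
  with k show ?thesis by (rule that)
qed

definition truncate :: "nat \<Rightarrow> ('a::real_normed_vector \<Rightarrow> real) \<Rightarrow> 'a \<Rightarrow> real" where
  "truncate n v x = indicator (cball 0 (real n)) x * max (- real n) (min (real n) (v x))"

lemma truncate_measurable [measurable]:
  fixes v :: "'a::euclidean_space \<Rightarrow> real"
  shows "v \<in> borel_measurable borel \<Longrightarrow> truncate n v \<in> borel_measurable borel"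
  unfolding truncate_def[abs_def]
  by (intro borel_measurable_times borel_measurable_indicator borel_measurable_max borel_measurable_min) auto

lemma
  shows abs_truncate_le: "\<bar>truncate n v x\<bar> \<le> \<bar>v x\<bar>"
    and abs_truncate_le_of_nat: "\<bar>truncate n v x\<bar> \<le> real n"
    and truncate_support: "truncate n v x \<noteq> 0 \<Longrightarrow> norm x \<le> real n"
  by (auto simp: truncate_def abs_mult indicator_def split: if_splits)

lemma truncate_tendsto: "(\<lambda>n. truncate n v x) \<longlonglongrightarrow> v x"
proof (rule tendsto_eventually)
  obtain m :: nat where m: "norm x + \<bar>v x\<bar> \<le> real m" using real_arch_simple by blast
  show "\<forall>\<^sub>F n in sequentially. truncate n v x = v x"
    using eventually_ge_at_top[of m]
  proof eventually_elim
    case (elim n)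
    with m have "norm x + \<bar>v x\<bar> \<le> real n" by linarith
    then have "norm x \<le> real n" "\<bar>v x\<bar> \<le> real n"
      using norm_ge_zero[of x] by linarith+
    then show ?case by (auto simp: truncate_def)
  qed
qed

lemma Cc_L1_dense:
  fixes v :: "'a::euclidean_space \<Rightarrow> real"
  assumes v: "integrable lborel v" and \<epsilon>: "\<epsilon> > 0"
  obtains k where "Cc k" "(\<integral>x. \<bar>k x - v x\<bar> \<partial>lborel) < \<epsilon>"
proof -
  have [measurable]: "v \<in> borel_measurable borel" using v by simp
  have "(\<lambda>n. \<integral>x. \<bar>truncate n v x - v x\<bar> \<partial>lborel) \<longlonglongrightarrow> 0"
    by (rule L1_dominated_convergence[where w = "\<lambda>x. \<bar>v x\<bar>"])
       (use v in \<open>auto simp: abs_truncate_le intro: truncate_tendsto\<close>)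
  from order_tendstoD(2)[OF this, of "\<epsilon> / 2"] obtain n
    where n: "(\<integral>x. \<bar>truncate n v x - v x\<bar> \<partial>lborel) < \<epsilon> / 2"
    using \<epsilon> by (auto simp: eventually_sequentially)
  obtain k where k: "Cc k" "(\<integral>x. \<bar>k x - truncate n v x\<bar> \<partial>lborel) < \<epsilon> / 2"
    using Cc_L1_dense_bounded[of "truncate n v" "real n" "real n" "\<epsilon> / 2"] \<epsilon>
    by (auto simp: abs_truncate_le_of_nat truncate_support)
  have [simp]: "integrable lborel k"
    using k(1) by (rule Cc_integrable)
  have [simp]: "integrable lborel (truncate n v)"
    using v by (rule Bochner_Integration.integrable_bound) (auto simp: abs_truncate_le)
  have "(\<integral>x. \<bar>k x - v x\<bar> \<partial>lborel) \<le> (\<integral>x. \<bar>k x - truncate n v x\<bar> + \<bar>truncate n v x - v x\<bar> \<partial>lborel)"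
    using v by (intro integral_mono) auto
  also have "\<dots> < \<epsilon>"
    using k(2) n v by simp
  finally show ?thesis
    using k(1) by (intro that)
qed

section \<open>Convolution with mollifiers\<close>

definition conv :: "('a::euclidean_space \<Rightarrow> real) \<Rightarrow> ('a \<Rightarrow> real) \<Rightarrow> 'a \<Rightarrow> real" where
  "conv \<eta> v x = (\<integral>y. \<eta> (x - y) * v y \<partial>lborel)"

lemma Cc_reflect:
  assumes "Cc g" shows "Cc (\<lambda>y. g (x - y))"
proof -
  have "continuous_on UNIV (\<lambda>y. g (x - y))"
    using assms unfolding Cc_def by (auto intro!: continuous_intros continuous_on_compose2[of UNIV g])
  moreover obtain R where R: "\<And>z. g z \<noteq> 0 \<Longrightarrow> norm z \<le> R"
    using assms by (auto simp: Cc_def bounded_iff)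
  have "norm y \<le> norm x + R" if "g (x - y) \<noteq> 0" for y
    using R[OF that] norm_triangle_ineq4[of x "x - y"] by simp
  then have "bounded {y. g (x - y) \<noteq> 0}"
    by (auto simp: bounded_iff)
  ultimately show ?thesis by (simp add: Cc_def)
qed

lemma conv_integrand_integrable:
  "Cc \<eta> \<Longrightarrow> integrable lborel v \<Longrightarrow> integrable lborel (\<lambda>y. \<eta> (x - y) * v y)"
  by (intro Cc_mult_integrable Cc_reflect integrable_imp_locally_integrable)

lemma conv_diff:
  assumes "Cc \<eta>" "integrable lborel v" "integrable lborel w"
  shows "conv \<eta> (\<lambda>x. v x - w x) x = conv \<eta> v x - conv \<eta> w x"
  using conv_integrand_integrable[OF assms(1,2), of x] conv_integrand_integrable[OF assms(1,3), of x]
  by (simp add: conv_def right_diff_distrib)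

lemma norm_le_of_conv_neq_0:
  assumes "\<And>x. \<eta> x \<noteq> 0 \<Longrightarrow> norm x \<le> r" "\<And>x. v x \<noteq> 0 \<Longrightarrow> norm x \<le> R" "conv \<eta> v x \<noteq> 0"
  shows "norm x \<le> r + R"
proof -
  have "(\<lambda>y. \<eta> (x - y) * v y) \<noteq> (\<lambda>_. 0)"
    using assms(3) by (auto simp: conv_def)
  then obtain y where "norm (x - y) \<le> r" "norm y \<le> R"
    using assms(1,2) by (auto simp: fun_eq_iff)
  then show ?thesis using norm_triangle_ineq[of "x - y" y] by simp
qed

definition mollifier :: "('a::euclidean_space \<Rightarrow> real) \<Rightarrow> bool" where
  "mollifier \<eta> \<longleftrightarrow> Cc \<eta> \<and> (\<forall>x. 0 \<le> \<eta> x) \<and> (\<integral>x. \<eta> x \<partial>lborel) = 1"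

lemma mollifierD:
  assumes "mollifier \<eta>"
  shows "Cc \<eta>" "0 \<le> \<eta> x" "(\<integral>x. \<eta> x \<partial>lborel) = 1" "\<eta> \<in> borel_measurable borel"
  using assms by (auto simp: mollifier_def intro: Cc_measurable)

lemma
  assumes \<eta>: "mollifier \<eta>"
  shows integrable_mollifier_reflect: "integrable lborel (\<lambda>y. \<eta> (x - y))"
    and integral_mollifier_reflect: "(\<integral>y. \<eta> (x - y) \<partial>lborel) = 1"
    and integrable_mollifier_translate: "integrable lborel (\<lambda>x. \<eta> (x - y))"
    and integral_mollifier_translate: "(\<integral>x. \<eta> (x - y) \<partial>lborel) = 1"
  using mollifierD[OF \<eta>] Cc_integrable[OF mollifierD(1)[OF \<eta>]]
    integrable_affine_unit[of \<eta> "-1" x] integral_affine_unit[of \<eta> "-1" x]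
    integrable_affine_unit[of \<eta> 1 "- y"] integral_affine_unit[of \<eta> 1 "- y"]
  by simp_all

lemma
  assumes \<eta>: "mollifier \<eta>" and v: "integrable lborel v"
  shows integrable_conv: "integrable lborel (conv \<eta> v)"
    and integral_conv: "(\<integral>x. conv \<eta> v x \<partial>lborel) = (\<integral>x. v x \<partial>lborel)"
proof -
  note [measurable] = mollifierD(4)[OF \<eta>] borel_measurable_integrable[OF v]
  have int: "integrable (lborel \<Otimes>\<^sub>M lborel) (\<lambda>(y, x). \<eta> (x - y) * v y)"
  proof (rule lborel_pair.Fubini_integrable)
    have "(\<lambda>y. \<integral>x. norm (case (y, x) of (y, x) \<Rightarrow> \<eta> (x - y) * v y) \<partial>lborel) = (\<lambda>y. \<bar>v y\<bar>)"
      using integral_mollifier_translate[OF \<eta>] by (simp add: abs_mult mollifierD(2)[OF \<eta>])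
    with v show "integrable lborel (\<lambda>y. \<integral>x. norm (case (y, x) of (y, x) \<Rightarrow> \<eta> (x - y) * v y) \<partial>lborel)"
      by simp
  qed (auto simp: integrable_mollifier_translate[OF \<eta>])
  show "integrable lborel (conv \<eta> v)"
    using lborel_pair.integrable_snd[OF int] by (simp add: conv_def[abs_def])
  have "(\<integral>x. conv \<eta> v x \<partial>lborel) = (\<integral>y. \<integral>x. \<eta> (x - y) * v y \<partial>lborel \<partial>lborel)"
    unfolding conv_def by (rule lborel_pair.Fubini_integral[OF int])
  then show "(\<integral>x. conv \<eta> v x \<partial>lborel) = (\<integral>x. v x \<partial>lborel)"
    by (simp add: integral_mollifier_translate[OF \<eta>])
qed

lemma integral_abs_conv_le:
  assumes \<eta>: "mollifier \<eta>" and v: "integrable lborel v"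
  shows "(\<integral>x. \<bar>conv \<eta> v x\<bar> \<partial>lborel) \<le> (\<integral>x. \<bar>v x\<bar> \<partial>lborel)"
proof -
  have "\<bar>conv \<eta> v x\<bar> \<le> conv \<eta> (\<lambda>y. \<bar>v y\<bar>) x" for x
    unfolding conv_def using v mollifierD(1,2)[OF \<eta>]
    by (intro integral_abs_bound_integral conv_integrand_integrable) (auto simp: abs_mult)
  then have "(\<integral>x. \<bar>conv \<eta> v x\<bar> \<partial>lborel) \<le> (\<integral>x. conv \<eta> (\<lambda>y. \<bar>v y\<bar>) x \<partial>lborel)"
    using integrable_conv[OF \<eta>] v by (intro integral_mono) auto
  also have "\<dots> = (\<integral>x. \<bar>v x\<bar> \<partial>lborel)"
    using v by (intro integral_conv \<eta>) auto
  finally show ?thesis .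
qed

lemma abs_conv_le_bound:
  assumes \<eta>: "mollifier \<eta>" and v: "integrable lborel v" "\<And>x. \<bar>v x\<bar> \<le> B"
  shows "\<bar>conv \<eta> v x\<bar> \<le> B"
proof -
  have "\<bar>conv \<eta> v x\<bar> \<le> (\<integral>y. B * \<eta> (x - y) \<partial>lborel)"
    unfolding conv_def
  proof (rule integral_abs_bound_integral)
    show "\<bar>\<eta> (x - y) * v y\<bar> \<le> B * \<eta> (x - y)" for y
      using mult_left_mono[OF v(2) mollifierD(2)[OF \<eta>]] mollifierD(2)[OF \<eta>]
      by (simp add: abs_mult mult.commute[of B])
  qed (use v(1) in \<open>auto intro: conv_integrand_integrable mollifierD[OF \<eta>] integrable_mollifier_reflect[OF \<eta>]\<close>)
  then show ?thesis by (simp add: integral_mollifier_reflect[OF \<eta>])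
qed

text \<open>The variance of \<open>g\<close> under the density \<open>\<eta> (x - y)\<close> is nonnegative.\<close>
lemma conv_power2_le:
  assumes \<eta>: "mollifier \<eta>" and [measurable]: "g \<in> borel_measurable borel"
    and g: "integrable lborel (\<lambda>x. (g x)\<^sup>2)"
  shows "(conv \<eta> g x)\<^sup>2 \<le> conv \<eta> (\<lambda>y. (g y)\<^sup>2) x"
proof -
  note [measurable] = mollifierD(4)[OF \<eta>]
  note \<eta>_integral = integrable_mollifier_reflect[OF \<eta>, of x] integral_mollifier_reflect[OF \<eta>, of x]
  have int2: "integrable lborel (\<lambda>y. \<eta> (x - y) * (g y)\<^sup>2)"
    by (rule conv_integrand_integrable[OF mollifierD(1)[OF \<eta>] g])
  have int1: "integrable lborel (\<lambda>y. \<eta> (x - y) * g y)"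
  proof (rule Bochner_Integration.integrable_bound)
    show "integrable lborel (\<lambda>y. \<eta> (x - y) * ((g y)\<^sup>2 + 1))"
      using int2 \<eta>_integral(1) by (simp add: distrib_left)
    have "\<bar>t\<bar> \<le> \<bar>t\<^sup>2 + 1\<bar>" for t :: real
      using zero_le_power2[of "\<bar>t\<bar> - 1"] by (simp add: power2_diff)
    then show "AE y in lborel. norm (\<eta> (x - y) * g y) \<le> norm (\<eta> (x - y) * ((g y)\<^sup>2 + 1))"
      by (auto simp: abs_mult intro!: mult_left_mono)
  qed measurable
  let ?m = "conv \<eta> g x"
  have "0 \<le> (\<integral>y. \<eta> (x - y) * (g y - ?m)\<^sup>2 \<partial>lborel)"
    using mollifierD(2)[OF \<eta>] by (intro Bochner_Integration.integral_nonneg) auto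
  also have "\<dots> = (\<integral>y. \<eta> (x - y) * (g y)\<^sup>2 - 2 * ?m * (\<eta> (x - y) * g y) + ?m\<^sup>2 * \<eta> (x - y) \<partial>lborel)"
    by (intro Bochner_Integration.integral_cong) (auto simp: power2_eq_square algebra_simps)
  also have "\<dots> = conv \<eta> (\<lambda>y. (g y)\<^sup>2) x - 2 * ?m * ?m + ?m\<^sup>2"
    using int1 int2 \<eta>_integral by (simp add: conv_def)
  finally show ?thesis by (simp add: power2_eq_square)
qed

lemma
  assumes \<eta>: "mollifier \<eta>" and [measurable]: "g \<in> borel_measurable borel"
    and g: "integrable lborel (\<lambda>x. (g x)\<^sup>2)"
  shows integrable_conv_power2: "integrable lborel (\<lambda>x. (conv \<eta> g x)\<^sup>2)"
    and integral_conv_power2_le: "(\<integral>x. (conv \<eta> g x)\<^sup>2 \<partial>lborel) \<le> (\<integral>x. (g x)\<^sup>2 \<partial>lborel)"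
proof -
  note [measurable] = mollifierD(4)[OF \<eta>]
  have [measurable]: "conv \<eta> g \<in> borel_measurable borel"
    unfolding conv_def[abs_def] by measurable
  have int: "integrable lborel (conv \<eta> (\<lambda>y. (g y)\<^sup>2))"
    by (rule integrable_conv[OF \<eta> g])
  then show int2: "integrable lborel (\<lambda>x. (conv \<eta> g x)\<^sup>2)"
    by (rule Bochner_Integration.integrable_bound)
       (use order_trans[OF conv_power2_le[OF assms] abs_ge_self] in auto)
  have "(\<integral>x. (conv \<eta> g x)\<^sup>2 \<partial>lborel) \<le> (\<integral>x. conv \<eta> (\<lambda>y. (g y)\<^sup>2) x \<partial>lborel)"
    by (rule integral_mono[OF int2 int conv_power2_le[OF assms]])
  also have "\<dots> = (\<integral>x. (g x)\<^sup>2 \<partial>lborel)"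
    by (rule integral_conv[OF \<eta> g])
  finally show "(\<integral>x. (conv \<eta> g x)\<^sup>2 \<partial>lborel) \<le> (\<integral>x. (g x)\<^sup>2 \<partial>lborel)" .
qed

definition approximate_identity :: "(nat \<Rightarrow> 'a::euclidean_space \<Rightarrow> real) \<Rightarrow> bool" where
  "approximate_identity \<eta> \<longleftrightarrow>
    (\<forall>n. mollifier (\<eta> n) \<and> (\<forall>x. inverse (real (Suc n)) \<le> norm x \<longrightarrow> \<eta> n x = 0))"

lemma approximate_identity_mollifier: "approximate_identity \<eta> \<Longrightarrow> mollifier (\<eta> n)"
  by (simp add: approximate_identity_def)

lemma approximate_identity_support:
  assumes "approximate_identity \<eta>" "\<eta> n x \<noteq> 0" shows "norm x \<le> 1"
proof (rule ccontr)
  assume "\<not> norm x \<le> 1"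
  moreover have "inverse (real (Suc n)) \<le> 1"
    by (simp add: field_simps)
  ultimately show False
    using assms by (auto simp: approximate_identity_def)
qed

lemma conv_mollifier_close:
  assumes \<eta>: "mollifier \<eta>" "\<And>x. d \<le> norm x \<Longrightarrow> \<eta> x = 0" and k: "integrable lborel k"
    and close: "\<And>y. dist y x < d \<Longrightarrow> \<bar>k y - k x\<bar> \<le> \<epsilon>"
  shows "\<bar>conv \<eta> k x - k x\<bar> \<le> \<epsilon>"
proof -
  note int = conv_integrand_integrable[OF mollifierD(1)[OF \<eta>(1)] k, of x]
    integrable_mollifier_reflect[OF \<eta>(1), of x]
  have "conv \<eta> k x - k x = (\<integral>y. \<eta> (x - y) * k y - k x * \<eta> (x - y) \<partial>lborel)"
    using int by (simp add: conv_def integral_mollifier_reflect[OF \<eta>(1)])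
  also have "\<bar>\<dots>\<bar> \<le> (\<integral>y. \<epsilon> * \<eta> (x - y) \<partial>lborel)"
  proof (rule integral_abs_bound_integral)
    fix y
    have "\<eta> (x - y) * \<bar>k y - k x\<bar> \<le> \<eta> (x - y) * \<epsilon>"
      using \<eta>(2)[of "x - y"] close[of y] mollifierD(2)[OF \<eta>(1), of "x - y"]
      by (cases "dist y x < d") (auto intro: mult_left_mono simp: dist_norm norm_minus_commute)
    then show "\<bar>\<eta> (x - y) * k y - k x * \<eta> (x - y)\<bar> \<le> \<epsilon> * \<eta> (x - y)"
      by (simp add: mult.commute[of _ "\<eta> _"] abs_mult mollifierD(2)[OF \<eta>(1)] flip: right_diff_distrib)
  qed (use int in simp_all)
  also have "\<dots> = \<epsilon>"
    by (simp add: integral_mollifier_reflect[OF \<eta>(1)])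
  finally show ?thesis .
qed

lemma approximate_identity_pointwise:
  assumes \<eta>: "approximate_identity \<eta>" and k: "integrable lborel k" "isCont k x"
  shows "(\<lambda>n. conv (\<eta> n) k x) \<longlonglongrightarrow> k x"
proof (rule tendstoI)
  fix \<epsilon> :: real assume "\<epsilon> > 0"
  then obtain d where d: "d > 0" "\<And>y. dist y x < d \<Longrightarrow> dist (k y) (k x) < \<epsilon> / 2"
    using k(2) unfolding continuous_at_eps_delta by (metis half_gt_zero)
  have "\<forall>\<^sub>F n in sequentially. inverse (real (Suc n)) < d"
    using LIMSEQ_inverse_real_of_nat d(1) by (rule order_tendstoD)
  then show "\<forall>\<^sub>F n in sequentially. dist (conv (\<eta> n) k x) (k x) < \<epsilon>"
  proof eventually_elim
    case (elim n)
    have "\<bar>conv (\<eta> n) k x - k x\<bar> \<le> \<epsilon> / 2"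
      using \<eta> d elim k(1)
      by (intro conv_mollifier_close[of _ d]) (auto simp: approximate_identity_def dist_real_def less_imp_le)
    with \<open>\<epsilon> > 0\<close> show ?case by (simp add: dist_real_def)
  qed
qed

lemma approximate_identity_L1_Cc:
  assumes \<eta>: "approximate_identity \<eta>" and k: "Cc k"
  shows "(\<lambda>n. \<integral>x. \<bar>conv (\<eta> n) k x - k x\<bar> \<partial>lborel) \<longlonglongrightarrow> 0"
proof -
  note mollifier = approximate_identity_mollifier[OF \<eta>]
  have int: "integrable lborel k" using k by (rule Cc_integrable)
  obtain B where B: "\<And>x. \<bar>k x\<bar> \<le> B" using Cc_bounded[OF k] by blast
  obtain R where R: "\<And>x. k x \<noteq> 0 \<Longrightarrow> norm x \<le> R" using k by (auto simp: Cc_def bounded_iff)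
  show ?thesis
  proof (rule L1_dominated_convergence[where w = "\<lambda>x. B * indicator (cball 0 (1 + R)) x"])
    show "integrable lborel (\<lambda>x::'a. B * indicator (cball 0 (1 + R)) x)"
      by (intro integrable_mult_right integrable_indicator_cball)
    show "AE x in lborel. (\<lambda>n. conv (\<eta> n) k x) \<longlonglongrightarrow> k x"
      using k by (intro AE_I2 approximate_identity_pointwise[OF \<eta> int])
        (simp add: Cc_def continuous_on_eq_continuous_at)
    show "AE x in lborel. \<bar>conv (\<eta> n) k x\<bar> \<le> B * indicator (cball 0 (1 + R)) x" for n
    proof (rule AE_I2)
      fix x
      show "\<bar>conv (\<eta> n) k x\<bar> \<le> B * indicator (cball 0 (1 + R)) x"
      proof (cases "conv (\<eta> n) k x = 0")
        case False
        with approximate_identity_support[OF \<eta>] R have "norm x \<le> 1 + R"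
          by (rule norm_le_of_conv_neq_0)
        then show ?thesis
          using abs_conv_le_bound[OF mollifier int B] by simp
      qed (use order_trans[OF abs_ge_zero B] in simp)
    qed
  qed (use integrable_conv[OF mollifier int] int in auto)
qed

lemma approximate_identity_L1:
  assumes \<eta>: "approximate_identity \<eta>" and v: "integrable lborel v"
  shows "(\<lambda>n. \<integral>x. \<bar>conv (\<eta> n) v x - v x\<bar> \<partial>lborel) \<longlonglongrightarrow> 0"
proof (rule LIMSEQ_I)
  fix \<epsilon> :: real assume \<epsilon>: "\<epsilon> > 0"
  note mollifier = approximate_identity_mollifier[OF \<eta>]
  obtain k where k: "Cc k" "(\<integral>x. \<bar>k x - v x\<bar> \<partial>lborel) < \<epsilon> / 3"
    using Cc_L1_dense[OF v, of "\<epsilon> / 3"] \<epsilon> by auto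
  have int: "integrable lborel k" using k(1) by (rule Cc_integrable)
  obtain N where N: "\<And>n. n \<ge> N \<Longrightarrow> (\<integral>x. \<bar>conv (\<eta> n) k x - k x\<bar> \<partial>lborel) < \<epsilon> / 3"
    using order_tendstoD(2)[OF approximate_identity_L1_Cc[OF \<eta> k(1)], of "\<epsilon> / 3"] \<epsilon>
    by (auto simp: eventually_sequentially)
  have "(\<integral>x. \<bar>conv (\<eta> n) v x - v x\<bar> \<partial>lborel) < \<epsilon>" if "n \<ge> N" for n
  proof -
    let ?K = "\<lambda>x. conv (\<eta> n) (\<lambda>x. k x - v x) x"
    have [simp]: "integrable lborel ?K" "integrable lborel (conv (\<eta> n) k)" "integrable lborel (conv (\<eta> n) v)"
      using int v by (auto intro: integrable_conv mollifier)
    have "(\<integral>x. \<bar>conv (\<eta> n) v x - v x\<bar> \<partial>lborel)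
        \<le> (\<integral>x. \<bar>?K x\<bar> + \<bar>conv (\<eta> n) k x - k x\<bar> + \<bar>k x - v x\<bar> \<partial>lborel)"
      using int v by (intro integral_mono) (auto simp: conv_diff[OF mollifierD(1)[OF mollifier] int v])
    also have "\<dots> = (\<integral>x. \<bar>?K x\<bar> \<partial>lborel) + (\<integral>x. \<bar>conv (\<eta> n) k x - k x\<bar> \<partial>lborel) + (\<integral>x. \<bar>k x - v x\<bar> \<partial>lborel)"
      using int v by simp
    also have "\<dots> < \<epsilon>"
      using integral_abs_conv_le[OF mollifier, of "\<lambda>x. k x - v x" n] int v N[OF that] k(2) by simp
    finally show ?thesis .
  qed
  then show "\<exists>N. \<forall>n\<ge>N. norm ((\<integral>x. \<bar>conv (\<eta> n) v x - v x\<bar> \<partial>lborel) - 0) < \<epsilon>"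
    by (intro exI[of _ N]) simp
qed

section \<open>Smooth functions\<close>

lemma has_derivative_grad:
  assumes "g differentiable (at x)"
  shows "(g has_derivative (\<lambda>h. grad g x \<bullet> h)) (at x)"
proof -
  let ?D = "frechet_derivative g (at x)"
  have D: "(g has_derivative ?D) (at x)"
    using assms by (simp add: frechet_derivative_works)
  then have lin: "linear ?D"
    using has_derivative_linear by blast
  have "?D h = grad g x \<bullet> h" for h
  proof -
    have "?D h = ?D (\<Sum>i\<in>UNIV. h $ i *s axis i 1)"
      by (simp only: basis_expansion)
    also have "\<dots> = (\<Sum>i\<in>UNIV. h $ i * ?D (axis i 1))"
      by (simp add: linear_sum[OF lin] scalar_mult_eq_scaleR linear_cmul[OF lin])
    also have "\<dots> = grad g x \<bullet> h"
      by (simp add: inner_vec_def grad_def partial_def mult.commute)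
    finally show ?thesis .
  qed
  then have "?D = (\<lambda>h. grad g x \<bullet> h)" by auto
  with D show ?thesis by simp
qed

lemma partial_eqI:
  "(g has_derivative g') (at x) \<Longrightarrow> partial i g x = g' (axis i 1)"
  unfolding partial_def using frechet_derivative_at by metis

lemma partial_const: "partial i (\<lambda>x. c) = (\<lambda>x. 0)"
  by (rule ext, subst partial_eqI[OF has_derivative_const]) (rule refl)

lemma partial_add:
  assumes "g differentiable (at x)" "h differentiable (at x)"
  shows "partial i (\<lambda>x. g x + h x) x = partial i g x + partial i h x"
  using partial_eqI[OF has_derivative_add[OF has_derivative_grad has_derivative_grad], OF assms]
  by (simp add: inner_axis grad_def)

lemma partial_mult:
  assumes "g differentiable (at x)" "h differentiable (at x)"
  shows "partial i (\<lambda>x. g x * h x) x = partial i g x * h x + g x * partial i h x"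
  using partial_eqI[OF has_derivative_mult[OF has_derivative_grad has_derivative_grad], OF assms]
  by (simp add: inner_axis grad_def)

lemma
  assumes "(\<rho> has_real_derivative d) (at (g x))" "g differentiable (at x)"
  shows differentiable_comp: "(\<lambda>x. \<rho> (g x)) differentiable (at x)"
    and partial_comp: "partial i (\<lambda>x. \<rho> (g x)) x = d * partial i g x"
proof -
  have deriv: "((\<lambda>x. \<rho> (g x)) has_derivative (\<lambda>h. d * (grad g x \<bullet> h))) (at x)"
    using has_derivative_compose[OF has_derivative_grad[OF assms(2)], of \<rho> "(*) d"] assms(1)
    by (simp add: has_field_derivative_def)
  then show "(\<lambda>x. \<rho> (g x)) differentiable (at x)"
    by (auto simp: differentiable_def)
  show "partial i (\<lambda>x. \<rho> (g x)) x = d * partial i g x"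
    using partial_eqI[OF deriv] by (simp add: inner_axis grad_def)
qed

lemma
  assumes "h differentiable (at (a + c *\<^sub>R x))"
  shows differentiable_affine: "(\<lambda>x. h (a + c *\<^sub>R x)) differentiable (at x)"
    and partial_affine: "partial i (\<lambda>x. h (a + c *\<^sub>R x)) x = c * partial i h (a + c *\<^sub>R x)"
proof -
  have "((\<lambda>x. a + c *\<^sub>R x) has_derivative (\<lambda>k. c *\<^sub>R k)) (at x)"
    by (auto intro!: derivative_eq_intros)
  from has_derivative_compose[OF this has_derivative_grad[OF assms]]
  have deriv: "((\<lambda>x. h (a + c *\<^sub>R x)) has_derivative
      (\<lambda>k. grad h (a + c *\<^sub>R x) \<bullet> c *\<^sub>R k)) (at x)" .
  then show "(\<lambda>x. h (a + c *\<^sub>R x)) differentiable (at x)"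
    by (auto simp: differentiable_def)
  show "partial i (\<lambda>x. h (a + c *\<^sub>R x)) x = c * partial i h (a + c *\<^sub>R x)"
    using partial_eqI[OF deriv] by (simp add: inner_axis grad_def)
qed

lemma partial_component: "partial i (\<lambda>x. x $ j) = (\<lambda>x. if i = j then 1 else 0)"
proof
  fix x :: R3
  have "((\<lambda>x. x $ j) has_derivative (\<lambda>x. x $ j)) (at x)"
    by (simp add: bounded_linear_imp_has_derivative bounded_linear_vec_nth)
  from partial_eqI[OF this] show "partial i (\<lambda>x. x $ j) x = (if i = j then 1 else 0)"
    by (simp add: axis_def)
qed

lemma norm_vec_power2: "(norm (x :: real ^ 'n))\<^sup>2 = (\<Sum>i\<in>UNIV. (x $ i)\<^sup>2)"
  by (simp add: norm_vec_def L2_set_def sum_nonneg)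

lemma partial_norm_power2: "partial i (\<lambda>x. (norm x)\<^sup>2) x = 2 * x $ i"
proof -
  have "((\<lambda>x. x \<bullet> x) has_derivative (\<lambda>h. x \<bullet> h + h \<bullet> x)) (at x)"
    by (auto intro!: derivative_eq_intros)
  from partial_eqI[OF this] show ?thesis
    by (simp add: power2_norm_eq_inner inner_axis inner_commute)
qed

lemma smooth3_coinduct:
  assumes "P g"
    and "\<And>g x. P g \<Longrightarrow> g differentiable (at x)"
    and "\<And>g i. P g \<Longrightarrow> P (partial i g)"
  shows "smooth3 g"
proof -
  have "P (foldr partial is g)" for "is"
    by (induction "is") (use assms in auto)
  then show ?thesis
    unfolding smooth3_def using assms(2) by blast
qed

lemma smooth3_differentiable: "smooth3 g \<Longrightarrow> g differentiable (at x)"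
  unfolding smooth3_def by (metis foldr_Nil id_apply)

lemma smooth3_partial: "smooth3 g \<Longrightarrow> smooth3 (partial i g)"
  by (rule smooth3_coinduct[where P = "\<lambda>h. \<exists>is. h = foldr partial is g"])
     (auto simp: smooth3_def intro: exI[of _ "[i]"] exI[of _ "_ # _"])

lemma smooth3_continuous: "smooth3 g \<Longrightarrow> continuous_on S g"
  by (simp add: continuous_at_imp_continuous_on differentiable_imp_continuous_within smooth3_differentiable)

lemma smooth3_measurable: "smooth3 g \<Longrightarrow> g \<in> borel_measurable borel"
  by (simp add: borel_measurable_continuous_onI smooth3_continuous)

lemma measurable_grad:
  assumes "smooth3 g" shows "grad g \<in> borel_measurable borel"
proof -
  have "continuous_on UNIV (\<lambda>x. \<chi> i. partial i g x)"
    using assms by (intro continuous_on_vec_lambda smooth3_continuous smooth3_partial)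
  then show ?thesis
    by (simp add: grad_def[abs_def] borel_measurable_continuous_onI)
qed

inductive_set generated_algebra :: "(R3 \<Rightarrow> real) set \<Rightarrow> (R3 \<Rightarrow> real) set" for B where
  base: "g \<in> B \<Longrightarrow> g \<in> generated_algebra B"
| const: "(\<lambda>x. c) \<in> generated_algebra B"
| add: "g \<in> generated_algebra B \<Longrightarrow> h \<in> generated_algebra B \<Longrightarrow> (\<lambda>x. g x + h x) \<in> generated_algebra B"
| mult: "g \<in> generated_algebra B \<Longrightarrow> h \<in> generated_algebra B \<Longrightarrow> (\<lambda>x. g x * h x) \<in> generated_algebra B"

lemma smooth3_generated_algebra:
  assumes "g \<in> generated_algebra B"
    and base_differentiable: "\<And>g x. g \<in> B \<Longrightarrow> g differentiable (at x)"
    and base_partial: "\<And>g i. g \<in> B \<Longrightarrow> partial i g \<in> generated_algebra B"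
  shows "smooth3 g"
proof (rule smooth3_coinduct[where P = "\<lambda>g. g \<in> generated_algebra B"])
  show differentiable: "g differentiable (at x)" if "g \<in> generated_algebra B" for g x
    using that by induction (auto intro: base_differentiable)
  show "partial i g \<in> generated_algebra B" if "g \<in> generated_algebra B" for g i
    using that
  proof induction
    case (const c)
    then show ?case by (simp add: partial_const generated_algebra.const)
  next
    case (add g h)
    have "partial i (\<lambda>x. g x + h x) = (\<lambda>x. partial i g x + partial i h x)"
      using add differentiable by (auto intro!: partial_add)
    with add show ?case by (auto intro: generated_algebra.add)
  next
    case (mult g h)
    have "partial i (\<lambda>x. g x * h x) = (\<lambda>x. partial i g x * h x + g x * partial i h x)"
      using mult differentiable by (auto intro!: partial_mult)
    with mult show ?case by (auto intro!: generated_algebra.add generated_algebra.mult)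
  qed (use base_partial in auto)
qed (use assms in auto)

lemma smooth3_algebra: "g \<in> generated_algebra {g. smooth3 g} \<Longrightarrow> smooth3 g"
  by (erule smooth3_generated_algebra)
     (auto intro: smooth3_differentiable smooth3_partial generated_algebra.base)

lemma smooth3_const: "smooth3 (\<lambda>x. c)"
  by (rule smooth3_algebra) (rule generated_algebra.const)

lemma smooth3_add: "smooth3 g \<Longrightarrow> smooth3 h \<Longrightarrow> smooth3 (\<lambda>x. g x + h x)"
  by (intro smooth3_algebra generated_algebra.add generated_algebra.base) auto

lemma smooth3_mult: "smooth3 g \<Longrightarrow> smooth3 h \<Longrightarrow> smooth3 (\<lambda>x. g x * h x)"
  by (intro smooth3_algebra generated_algebra.mult generated_algebra.base) auto

lemma smooth3_diff: "smooth3 g \<Longrightarrow> smooth3 h \<Longrightarrow> smooth3 (\<lambda>x. g x - h x)"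
  using smooth3_add[of g "\<lambda>x. (-1) * h x"] smooth3_mult[OF smooth3_const, of h "-1"] by simp

lemma smooth3_power: "smooth3 g \<Longrightarrow> smooth3 (\<lambda>x. g x ^ n)"
  by (induction n) (auto intro: smooth3_const smooth3_mult)

lemma smooth3_sum: "(\<And>j. j \<in> J \<Longrightarrow> smooth3 (g j)) \<Longrightarrow> smooth3 (\<lambda>x. \<Sum>j\<in>J. g j x)"
  by (induction J rule: infinite_finite_induct) (auto intro: smooth3_const smooth3_add)

lemma smooth3_component: "smooth3 (\<lambda>x. x $ j)"
proof (rule smooth3_generated_algebra[where B = "{\<lambda>x. x $ j}"])
  show "g differentiable (at x)" if "g \<in> {\<lambda>x. x $ j}" for g x
    using that by (auto intro!: bounded_linear_imp_differentiable bounded_linear_vec_nth)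
qed (auto simp: partial_component intro: generated_algebra.intros)

lemma smooth3_norm_power2: "smooth3 (\<lambda>x. (norm x)\<^sup>2)"
  unfolding norm_vec_power2 by (intro smooth3_sum smooth3_power smooth3_component)

lemma smooth3_affine:
  assumes "smooth3 h" shows "smooth3 (\<lambda>x. h (a + c *\<^sub>R x))"
proof -
  let ?P = "\<lambda>g. \<exists>b k. smooth3 k \<and> g = (\<lambda>x. b * k (a + c *\<^sub>R x))"
  have "smooth3 (\<lambda>x. 1 * h (a + c *\<^sub>R x))"
  proof (rule smooth3_coinduct[where P = ?P])
    fix g and x :: R3 assume "?P g"
    then obtain b k where k: "smooth3 k" "g = (\<lambda>x. b * k (a + c *\<^sub>R x))" by blast
    show "g differentiable (at x)"
      unfolding k(2)
      by (intro differentiable_mult differentiable_const differentiable_affine smooth3_differentiable k(1))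
  next
    fix g i assume "?P g"
    then obtain b k where k: "smooth3 k" "g = (\<lambda>x. b * k (a + c *\<^sub>R x))" by blast
    have "partial i g = (\<lambda>x. (b * c) * partial i k (a + c *\<^sub>R x))"
      using smooth3_differentiable[OF k(1)]
      by (auto simp: k(2) partial_mult differentiable_affine partial_affine partial_const)
    with k(1) show "?P (partial i g)" by (blast intro: smooth3_partial)
  qed (use assms in blast)
  then show ?thesis by simp
qed

definition smooth_on :: "real set \<Rightarrow> (real \<Rightarrow> real) \<Rightarrow> bool" where
  "smooth_on T \<rho> \<longleftrightarrow> (\<forall>n. \<forall>t\<in>T. (deriv ^^ n) \<rho> field_differentiable (at t))"

lemma smooth_on_coinduct:
  assumes T: "open T" and "P \<rho>"
    and step: "\<And>\<sigma>. P \<sigma> \<Longrightarrow> \<exists>\<tau>. P \<tau> \<and> (\<forall>t\<in>T. (\<sigma> has_real_derivative \<tau> t) (at t))"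
  shows "smooth_on T \<rho>"
proof -
  have deriv: "\<exists>\<tau>. P \<tau> \<and> (\<forall>t\<in>T. (g has_real_derivative \<tau> t) (at t))"
    if g: "\<exists>\<sigma>. P \<sigma> \<and> (\<forall>t\<in>T. g t = \<sigma> t)" for g
  proof -
    obtain \<sigma> where \<sigma>: "P \<sigma>" "\<And>t. t \<in> T \<Longrightarrow> \<sigma> t = g t" using g by metis
    obtain \<tau> where \<tau>: "P \<tau>" "\<And>t. t \<in> T \<Longrightarrow> (\<sigma> has_real_derivative \<tau> t) (at t)" using step[OF \<sigma>(1)] by blast
    have "(g has_real_derivative \<tau> t) (at t)" if "t \<in> T" for t
      using \<tau>(2)[OF that] T that \<sigma>(2) by (rule has_field_derivative_transform_within_open)
    with \<tau>(1) show ?thesis by blast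
  qed
  have "\<exists>\<sigma>. P \<sigma> \<and> (\<forall>t\<in>T. (deriv ^^ n) \<rho> t = \<sigma> t)" for n
  proof (induction n)
    case (Suc n)
    from deriv[OF this] show ?case by (auto intro: DERIV_imp_deriv)
  qed (use assms(2) in auto)
  from deriv[OF this] show ?thesis
    unfolding smooth_on_def field_differentiable_def by blast
qed

lemma smooth3_comp:
  assumes \<rho>: "smooth_on T \<rho>" and g: "smooth3 g" "\<And>x. g x \<in> T"
  shows "smooth3 (\<lambda>x. \<rho> (g x))"
proof -
  let ?D = "\<lambda>n x. (deriv ^^ n) \<rho> (g x)"
  let ?B = "{h. smooth3 h} \<union> range ?D"
  have deriv: "((deriv ^^ n) \<rho> has_real_derivative ?D (Suc n) x) (at (g x))" for n x
    using \<rho> g(2) by (simp add: smooth_on_def field_differentiable_derivI)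
  have "?D 0 \<in> generated_algebra ?B"
    by (rule generated_algebra.base) blast
  then have "smooth3 (?D 0)"
  proof (rule smooth3_generated_algebra)
    show "h differentiable (at x)" if "h \<in> ?B" for h x
      using that differentiable_comp[OF deriv smooth3_differentiable[OF g(1)]]
      by (blast intro: smooth3_differentiable)
    show "partial i h \<in> generated_algebra ?B" if "h \<in> ?B" for h i
    proof (cases "smooth3 h")
      case False
      with that obtain n where "h = ?D n" by blast
      then have "partial i h = (\<lambda>x. ?D (Suc n) x * partial i g x)"
        using partial_comp[OF deriv smooth3_differentiable[OF g(1)]] by blast
      moreover have "?D (Suc n) \<in> generated_algebra ?B" "partial i g \<in> generated_algebra ?B"
        using g(1) by (auto intro!: generated_algebra.base smooth3_partial simp del: funpow.simps)
      ultimately show ?thesis by (simp only: generated_algebra.mult)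
    qed (auto intro: generated_algebra.base smooth3_partial)
  qed
  then show ?thesis by simp
qed

lemma smooth_on_powr: "smooth_on {0<..} (\<lambda>t. t powr a)"
proof (rule smooth_on_coinduct[where P = "\<lambda>\<sigma>. \<exists>c b. \<sigma> = (\<lambda>t. c * t powr b)"])
  fix \<sigma> :: "real \<Rightarrow> real" assume "\<exists>c b. \<sigma> = (\<lambda>t. c * t powr b)"
  then obtain c b where \<sigma>: "\<sigma> = (\<lambda>t. c * t powr b)" by blast
  have "(\<sigma> has_real_derivative (c * b) * t powr (b - 1)) (at t)" if "t > 0" for t
    using DERIV_cmult[OF has_real_derivative_powr[OF that, of b], of c] by (simp add: \<sigma> mult.assoc)
  then show "\<exists>\<tau>. (\<exists>c b. \<tau> = (\<lambda>t. c * t powr b)) \<and> (\<forall>t\<in>{0<..}. (\<sigma> has_real_derivative \<tau> t) (at t))"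
    by (intro exI[of _ "\<lambda>t. (c * b) * t powr (b - 1)"]) auto
next
  show "\<exists>c b. (\<lambda>t. t powr a) = (\<lambda>t. c * t powr b)"
    by (intro exI[of _ 1] exI[of _ a]) simp
qed simp

lemma smooth3_powr: "smooth3 g \<Longrightarrow> (\<And>x. g x > 0) \<Longrightarrow> smooth3 (\<lambda>x. g x powr a)"
  by (rule smooth3_comp[OF smooth_on_powr]) auto

definition flat :: "real poly \<Rightarrow> real \<Rightarrow> real" where
  "flat p t = (if t > 0 then poly p (1 / t) * exp (- 1 / t) else 0)"

lemma poly_over_exp_tendsto_0: "((\<lambda>y::real. poly p y / exp y) \<longlongrightarrow> 0) at_top"
proof -
  have "((\<lambda>y. \<Sum>i\<le>degree p. coeff p i * (y ^ i / exp y)) \<longlongrightarrow> (\<Sum>i\<le>degree p. coeff p i * 0)) at_top"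
    by (intro tendsto_intros tendsto_power_div_exp_0)
  then show ?thesis by (simp add: poly_altdef sum_divide_distrib)
qed

lemma flat_tendsto_0: "(flat p \<longlongrightarrow> 0) (at 0)"
proof -
  have "((\<lambda>t::real. poly p (inverse t) / exp (inverse t)) \<longlongrightarrow> 0) (at_right 0)"
    by (rule filterlim_compose[OF poly_over_exp_tendsto_0 filterlim_inverse_at_top_right])
  then have "(flat p \<longlongrightarrow> 0) (at_right 0)"
  proof (rule Lim_transform_eventually)
    show "\<forall>\<^sub>F t in at_right 0. poly p (inverse t) / exp (inverse t) = flat p t"
      using eventually_at_right_less[of 0]
      by eventually_elim (simp add: flat_def exp_minus divide_inverse)
  qed
  moreover have "(flat p \<longlongrightarrow> 0) (at_left 0)"
  proof (rule Lim_transform_eventually[OF tendsto_const])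
    show "\<forall>\<^sub>F t in at_left 0. 0 = flat p t"
      unfolding eventually_at_left_field by (auto simp: flat_def intro!: exI[of _ "-1"])
  qed
  ultimately show ?thesis
    by (simp add: filterlim_split_at)
qed

lemma has_real_derivative_flat:
  "(flat p has_real_derivative flat ([:0, 0, 1:] * (p - pderiv p)) t) (at t)"
proof (cases t "0::real" rule: linorder_cases)
  case less
  have "((\<lambda>_. 0) has_real_derivative 0) (at t)" by simp
  then have "(flat p has_real_derivative 0) (at t)"
    by (rule has_field_derivative_transform_within_open[of _ _ _ "{..<0}"])
       (use less in \<open>auto simp: flat_def\<close>)
  with less show ?thesis by (simp add: flat_def)
next
  case equal
  have "flat p t / t = flat (pCons 0 p) t" for t
    by (simp add: flat_def)
  moreover have "flat q 0 = 0" for q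
    by (simp add: flat_def)
  ultimately show ?thesis
    using flat_tendsto_0[of "pCons 0 p"] by (simp add: equal has_field_derivative_iff)
next
  case greater
  have "((\<lambda>t. poly p (1 / t) * exp (- 1 / t)) has_real_derivative
      flat ([:0, 0, 1:] * (p - pderiv p)) t) (at t)"
    using greater
    by (auto intro!: derivative_eq_intros DERIV_chain2[OF poly_DERIV]
        simp: flat_def field_simps power2_eq_square)
  then show ?thesis
    by (rule has_field_derivative_transform_within_open[of _ _ _ "{0<..}"])
       (use greater in \<open>auto simp: flat_def\<close>)
qed

lemma smooth_on_flat: "smooth_on UNIV (flat p)"
  by (rule smooth_on_coinduct[where P = "\<lambda>\<sigma>. \<sigma> \<in> range flat"]) (use has_real_derivative_flat in blast)+

definition bump :: "R3 \<Rightarrow> real" where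
  "bump x = flat 1 (1 - (norm x)\<^sup>2)"

lemma smooth3_bump: "smooth3 bump"
  unfolding bump_def[abs_def]
  by (intro smooth3_comp[OF smooth_on_flat] smooth3_diff smooth3_const smooth3_norm_power2) auto

lemma bump_nonneg: "0 \<le> bump x"
  and bump_le: "bump x \<le> bump 0"
  and bump_0: "0 < bump 0"
  by (auto simp: bump_def flat_def field_simps)

lemma bump_eq_0: "1 \<le> norm x \<Longrightarrow> bump x = 0"
  by (simp add: bump_def flat_def leD[OF one_le_power])

section \<open>Test functions\<close>

lemma test_fun_iff: "test_fun g \<longleftrightarrow> smooth3 g \<and> bounded {x. g x \<noteq> 0}"
  by (simp add: test_fun_def compact_closure)

lemma test_fun_smooth3: "test_fun g \<Longrightarrow> smooth3 g"
  by (simp add: test_fun_iff)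

lemma test_fun_differentiable: "test_fun g \<Longrightarrow> g differentiable (at x)"
  by (simp add: test_fun_smooth3 smooth3_differentiable)

lemma test_fun_Cc: "test_fun g \<Longrightarrow> Cc g"
  by (simp add: test_fun_iff Cc_def smooth3_continuous)

lemma test_fun_integrable: "test_fun g \<Longrightarrow> integrable lborel g"
  by (intro Cc_integrable test_fun_Cc)

lemma test_fun_measurable: "test_fun g \<Longrightarrow> g \<in> borel_measurable borel"
  by (intro smooth3_measurable test_fun_smooth3)

lemma test_fun_mult: "smooth3 g \<Longrightarrow> test_fun h \<Longrightarrow> test_fun (\<lambda>x. g x * h x)"
  unfolding test_fun_iff using smooth3_mult[of g h]
  by (auto elim!: bounded_subset)

lemma test_fun_bump: "test_fun bump"
proof -
  have "{x. bump x \<noteq> 0} \<subseteq> cball 0 1"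
    using bump_eq_0 by force
  then show ?thesis
    using smooth3_bump bounded_subset[OF bounded_cball] by (auto simp: test_fun_iff)
qed

lemma partial_transform_within_open:
  assumes "h differentiable (at x)" "open S" "x \<in> S" "\<And>y. y \<in> S \<Longrightarrow> h y = g y"
  shows "partial i g x = partial i h x"
  unfolding partial_def using frechet_derivative_transform_within_open[OF assms] by simp

lemma partial_support: "{x. partial i g x \<noteq> 0} \<subseteq> closure {x. g x \<noteq> 0}"
proof (rule subsetI, rule ccontr)
  fix x assume x: "x \<in> {x. partial i g x \<noteq> 0}" "x \<notin> closure {x. g x \<noteq> 0}"
  have "partial i g x = partial i (\<lambda>_. 0) x"
    using x(2) closure_subset[of "{x. g x \<noteq> 0}"]
    by (intro partial_transform_within_open[of _ _ "- closure {x. g x \<noteq> 0}"]) auto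
  with x(1) show False by (simp add: partial_const)
qed

lemma test_fun_partial: "test_fun g \<Longrightarrow> test_fun (partial i g)"
  unfolding test_fun_iff by (auto intro: smooth3_partial bounded_subset[OF bounded_closure partial_support])

lemma test_fun_affine:
  assumes "test_fun h" "c \<noteq> 0" shows "test_fun (\<lambda>x. h (a + c *\<^sub>R x))"
proof -
  have "{x. h (a + c *\<^sub>R x) \<noteq> 0} \<subseteq> (\<lambda>y. (1 / c) *\<^sub>R y) ` ((\<lambda>y. - a + y) ` {x. h x \<noteq> 0})"
    using assms(2) by (auto simp: image_iff intro!: exI[of _ "a + c *\<^sub>R _"])
  moreover have "bounded ((\<lambda>y. (1 / c) *\<^sub>R y) ` ((\<lambda>y. - a + y) ` {x. h x \<noteq> 0}))"
    using assms(1) by (intro bounded_scaling bounded_translation) (simp add: test_fun_iff)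
  ultimately show ?thesis
    using assms unfolding test_fun_iff by (auto intro: smooth3_affine bounded_subset)
qed

lemma test_fun_scaleR: "test_fun h \<Longrightarrow> c \<noteq> 0 \<Longrightarrow> test_fun (\<lambda>x. h (c *\<^sub>R x))"
  using test_fun_affine[of h c 0] by simp

lemma norm_grad_power2: "(norm (grad g x))\<^sup>2 = (\<Sum>i\<in>UNIV. (partial i g x)\<^sup>2)"
  by (simp add: norm_vec_power2 grad_def)

lemma integrable_partial_power2: "test_fun g \<Longrightarrow> integrable lborel (\<lambda>x. (partial i g x)\<^sup>2)"
  unfolding power2_eq_square
  by (intro test_fun_integrable test_fun_mult smooth3_partial test_fun_partial test_fun_smooth3)

lemma integrable_grad_power2: "test_fun g \<Longrightarrow> integrable lborel (\<lambda>x. (norm (grad g x))\<^sup>2)"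
  unfolding norm_grad_power2 by (intro Bochner_Integration.integrable_sum integrable_partial_power2)

lemma test_fun_grad_bounded:
  assumes "test_fun g" obtains B where "\<And>x. norm (grad g x) \<le> B"
proof -
  have "\<exists>B. \<forall>x. \<bar>partial i g x\<bar> \<le> B" for i
    using Cc_bounded[OF test_fun_Cc[OF test_fun_partial[OF assms]]] by metis
  then obtain B where B: "\<And>i x. \<bar>partial i g x\<bar> \<le> B i"
    by metis
  have "norm (grad g x) \<le> (\<Sum>i\<in>UNIV. B i)" for x
    using norm_le_l1_cart[of "grad g x"] by (rule order_trans) (auto simp: grad_def intro: sum_mono B)
  then show ?thesis by (rule that)
qed

section \<open>Smoothing by convolution\<close>

lemma
  assumes \<eta>: "test_fun \<eta>" and v: "integrable lborel v"
  shows differentiable_conv: "conv \<eta> v differentiable (at x)"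
    and partial_conv: "partial i (conv \<eta> v) x = conv (partial i \<eta>) v x"
proof -
  obtain B where B: "\<And>x. norm (grad \<eta> x) \<le> B"
    using test_fun_grad_bounded[OF \<eta>] by blast
  note [measurable] = measurable_grad[OF test_fun_smooth3[OF \<eta>]] borel_measurable_integrable[OF v]
  let ?G = "\<lambda>x y. v y *\<^sub>R grad \<eta> (x - y)"
  have bound: "norm (?G x y) \<le> B * \<bar>v y\<bar>" for x y
    using mult_right_mono[OF B abs_ge_zero, of "x - y" "v y"] by (simp add: mult.commute)
  have int: "integrable lborel (?G x)"
  proof (rule Bochner_Integration.integrable_bound)
    show "integrable lborel (\<lambda>y. B * \<bar>v y\<bar>)" using v by simp
  qed (use order_trans[OF bound abs_ge_self] in auto)
  have deriv: "(conv \<eta> v has_derivative (\<lambda>h. (\<integral>y. ?G x y \<partial>lborel) \<bullet> h)) (at x)"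
    unfolding conv_def[abs_def]
  proof (rule has_derivative_integral[where w = "\<lambda>y. B * \<bar>v y\<bar>"])
    fix x y
    have "((\<lambda>x. \<eta> (x - y)) has_derivative (\<lambda>h. grad \<eta> (x - y) \<bullet> h)) (at x)"
      by (rule has_derivative_compose[OF _ has_derivative_grad[OF test_fun_differentiable[OF \<eta>]]])
         (auto intro!: derivative_eq_intros)
    then show "((\<lambda>x. \<eta> (x - y) * v y) has_derivative (\<lambda>h. ?G x y \<bullet> h)) (at x)"
      by (auto intro!: derivative_eq_intros simp: mult.commute)
  qed (use v bound in \<open>auto intro: conv_integrand_integrable test_fun_Cc \<eta>\<close>)
  then show "conv \<eta> v differentiable (at x)"
    by (auto simp: differentiable_def)
  have "partial i (conv \<eta> v) x = (\<integral>y. ?G x y \<bullet> axis i 1 \<partial>lborel)"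
    unfolding partial_eqI[OF deriv] by (rule integral_inner_left[symmetric]) (rule int)
  also have "\<dots> = conv (partial i \<eta>) v x"
    unfolding conv_def by (intro Bochner_Integration.integral_cong) (auto simp: inner_axis grad_def)
  finally show "partial i (conv \<eta> v) x = conv (partial i \<eta>) v x" .
qed

lemma smooth3_conv:
  assumes "test_fun \<eta>" "integrable lborel v"
  shows "smooth3 (conv \<eta> v)"
proof (rule smooth3_coinduct[where P = "\<lambda>g. \<exists>\<eta>. test_fun \<eta> \<and> g = conv \<eta> v"])
  show "\<exists>\<eta>'. test_fun \<eta>' \<and> partial i g = conv \<eta>' v" if g: "\<exists>\<eta>. test_fun \<eta> \<and> g = conv \<eta> v" for g i
  proof -
    obtain \<eta> where \<eta>: "test_fun \<eta>" "g = conv \<eta> v" using g by blast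
    then have "partial i g = conv (partial i \<eta>) v"
      using partial_conv[OF \<eta>(1) assms(2)] by auto
    with \<eta>(1) show ?thesis by (blast intro: test_fun_partial)
  qed
qed (use assms in \<open>auto intro: differentiable_conv\<close>)

lemma test_fun_conv:
  assumes "test_fun \<eta>" "integrable lborel v" "bounded {x. v x \<noteq> 0}"
  shows "test_fun (conv \<eta> v)"
proof -
  obtain r R where "\<And>x. \<eta> x \<noteq> 0 \<Longrightarrow> norm x \<le> r" "\<And>x. v x \<noteq> 0 \<Longrightarrow> norm x \<le> R"
    using assms(1,3) by (auto simp: test_fun_iff bounded_iff)
  then have "\<And>x. conv \<eta> v x \<noteq> 0 \<Longrightarrow> norm x \<le> r + R" by (rule norm_le_of_conv_neq_0)
  then have "bounded {x. conv \<eta> v x \<noteq> 0}" by (auto simp: bounded_iff)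
  with smooth3_conv[OF assms(1,2)] show ?thesis by (simp add: test_fun_iff)
qed

lemma integral_Cc_pos:
  fixes g :: "'a::euclidean_space \<Rightarrow> real"
  assumes g: "Cc g" "\<And>x. 0 \<le> g x" and pos: "0 < g a"
  shows "0 < (\<integral>x. g x \<partial>lborel)"
proof -
  have [measurable]: "g \<in> borel_measurable borel"
    using g(1) by (rule Cc_measurable)
  have "(\<integral>x. g x \<partial>lborel) \<noteq> 0"
  proof
    assume "(\<integral>x. g x \<partial>lborel) = 0"
    then have "AE x in lborel. g x = 0"
      using integral_nonneg_eq_0_iff_AE[OF Cc_integrable[OF g(1)]] g(2) by auto
    then have "{x. g x \<noteq> 0} \<in> null_sets lborel"
      by (subst (asm) AE_iff_null) auto
    then have "negligible {x. g x \<noteq> 0}"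
      by (simp add: negligible_iff_null_sets null_sets_completionI)
    moreover have "open {x. g x \<noteq> 0}"
      using g(1) by (intro open_Collect_neq) (auto simp: Cc_def)
    moreover have "a \<in> {x. g x \<noteq> 0}"
      using pos by simp
    ultimately show False
      using open_not_negligible by blast
  qed
  moreover have "0 \<le> (\<integral>x. g x \<partial>lborel)"
    using g(2) by simp
  ultimately show ?thesis by simp
qed

lemma approximate_identity_exists:
  obtains \<eta> where "approximate_identity \<eta>" "\<And>n. test_fun (\<eta> n)"
proof -
  define b where "b n = (\<lambda>x. bump (real (Suc n) *\<^sub>R x))" for n
  have b: "test_fun (b n)" for n
    unfolding b_def by (intro test_fun_scaleR test_fun_bump) simp
  have nonneg: "0 \<le> b n x" for n x
    by (simp add: b_def bump_nonneg)
  have pos: "0 < (\<integral>x. b n x \<partial>lborel)" for n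
    by (rule integral_Cc_pos[of _ 0]) (use test_fun_Cc[OF b] nonneg bump_0 in \<open>auto simp: b_def\<close>)
  define \<eta> where "\<eta> n = (\<lambda>x. (1 / (\<integral>x. b n x \<partial>lborel)) * b n x)" for n
  have \<eta>: "test_fun (\<eta> n)" for n
    unfolding \<eta>_def by (intro test_fun_mult smooth3_const b)
  have "approximate_identity \<eta>"
    unfolding approximate_identity_def
  proof (intro allI conjI impI)
    show "mollifier (\<eta> n)" for n
      unfolding mollifier_def using test_fun_Cc[OF \<eta>] nonneg pos[of n] by (auto simp: \<eta>_def)
    fix n and x :: R3 assume "inverse (real (Suc n)) \<le> norm x"
    then have "1 \<le> real (Suc n) * norm x"
      by (simp add: field_simps)
    then have "1 \<le> norm (real (Suc n) *\<^sub>R x)"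
      by (simp del: of_nat_Suc)
    then show "\<eta> n x = 0"
      by (simp add: \<eta>_def b_def bump_eq_0)
  qed
  then show ?thesis using \<eta> by (rule that)
qed

section \<open>Integration by parts and weak gradients\<close>

text \<open>Convolving \<open>\<psi>\<close> with the indicator of a large ball gives a function that is constant near 0.\<close>
lemma integral_partial_test_fun:
  assumes \<psi>: "test_fun \<psi>" shows "(\<integral>x. partial i \<psi> x \<partial>lborel) = 0"
proof -
  obtain R where R: "\<And>x. \<psi> x \<noteq> 0 \<Longrightarrow> norm x \<le> R"
    using \<psi> by (auto simp: test_fun_iff bounded_iff)
  define v :: "R3 \<Rightarrow> real" where "v = indicator (cball 0 (R + 1))"
  have v: "integrable lborel v"
    unfolding v_def by (rule integrable_indicator_cball)
  have reflect: "(\<integral>y. g (x - y) \<partial>lborel) = (\<integral>y. g y \<partial>lborel)" if "test_fun g" for g x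
    using integral_affine_unit[of g "-1" x] test_fun_measurable[OF that] by simp
  have conv_v: "conv g v x = (\<integral>y. g y \<partial>lborel)"
    if g: "test_fun g" "{x. g x \<noteq> 0} \<subseteq> cball 0 R" and x: "norm x < 1" for g x
  proof -
    have mult_v: "g (x - y) * v y = g (x - y)" for y
    proof (cases "g (x - y) = 0")
      case False
      with g(2) have "norm (x - y) \<le> R" by auto
      moreover have "norm y \<le> norm x + norm (x - y)"
        using norm_triangle_ineq4[of x "x - y"] by simp
      ultimately show ?thesis using x by (simp add: v_def)
    qed simp
    show ?thesis by (simp only: conv_def mult_v reflect[OF g(1)])
  qed
  have supp: "{x. \<psi> x \<noteq> 0} \<subseteq> cball 0 R"
    using R by auto
  then have supp_partial: "{x. partial i \<psi> x \<noteq> 0} \<subseteq> cball 0 R"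
    using order_trans[OF partial_support closure_minimal[OF _ closed_cball]] by blast
  have "(\<integral>x. partial i \<psi> x \<partial>lborel) = conv (partial i \<psi>) v 0"
    by (rule conv_v[symmetric]) (use supp_partial test_fun_partial[OF \<psi>] in auto)
  also have "\<dots> = partial i (conv \<psi> v) 0"
    by (rule partial_conv[OF \<psi> v, symmetric])
  also have "\<dots> = partial i (\<lambda>_. \<integral>y. \<psi> y \<partial>lborel) 0"
    by (rule partial_transform_within_open[of _ _ "ball 0 1"]) (use conv_v[OF \<psi> supp] in auto)
  also have "\<dots> = 0"
    by (simp add: partial_const)
  finally show ?thesis .
qed

lemma integral_by_parts_test_fun:
  assumes "smooth3 g" "test_fun h"
  shows "(\<integral>x. g x * partial i h x \<partial>lborel) = - (\<integral>x. partial i g x * h x \<partial>lborel)"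
proof -
  have "partial i (\<lambda>x. g x * h x) x = partial i g x * h x + g x * partial i h x" for x
    using assms by (intro partial_mult smooth3_differentiable test_fun_differentiable)
  then have "(\<integral>x. partial i g x * h x + g x * partial i h x \<partial>lborel) = 0"
    using integral_partial_test_fun[OF test_fun_mult[OF assms], of i] by simp
  moreover have "integrable lborel (\<lambda>x. partial i g x * h x)" "integrable lborel (\<lambda>x. g x * partial i h x)"
    using assms by (auto intro!: test_fun_integrable test_fun_mult smooth3_partial test_fun_partial)
  ultimately show ?thesis by simp
qed

lemma weak_gradD:
  assumes "weak_grad u G"
  shows "u \<in> borel_measurable borel" "G \<in> borel_measurable borel"
    "locally_integrable u" "locally_integrable (\<lambda>x. G x $ i)"
    "test_fun \<psi> \<Longrightarrow> (\<integral>x. u x * partial i \<psi> x \<partial>lborel) = - (\<integral>x. G x $ i * \<psi> x \<partial>lborel)"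
  using assms by (auto simp: weak_grad_def locally_integrable_def)

lemma weak_gradI:
  assumes "u \<in> borel_measurable borel" "G \<in> borel_measurable borel"
    "locally_integrable u" "\<And>i. locally_integrable (\<lambda>x. G x $ i)"
    "\<And>\<psi> i. test_fun \<psi> \<Longrightarrow> (\<integral>x. u x * partial i \<psi> x \<partial>lborel) = - (\<integral>x. G x $ i * \<psi> x \<partial>lborel)"
  shows "weak_grad u G"
  using assms by (auto simp: weak_grad_def locally_integrable_def)

lemma weak_grad_smooth3: "smooth3 g \<Longrightarrow> weak_grad g (grad g)"
  by (rule weak_gradI)
     (auto simp: grad_def[of _ "_"] integral_by_parts_test_fun intro: smooth3_measurable measurable_grad
       locally_integrable_continuous smooth3_continuous smooth3_partial)

lemma D12_grad_test_fun:
  assumes "test_fun \<psi>" shows "D12_grad \<psi> (grad \<psi>)"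
  using assms
  by (auto simp: D12_grad_def L2vec_def intro!: exI[of _ "\<lambda>_. \<psi>"] weak_grad_smooth3 measurable_grad
      integrable_grad_power2 test_fun_smooth3)

lemma partial_conv_weak_grad:
  assumes \<eta>: "test_fun \<eta>" and v: "integrable lborel v" and G: "weak_grad v G"
  shows "partial i (conv \<eta> v) x = conv \<eta> (\<lambda>y. G y $ i) x"
proof -
  define \<psi> where "\<psi> = (\<lambda>y. \<eta> (x + (-1) *\<^sub>R y))"
  have \<psi>: "test_fun \<psi>"
    unfolding \<psi>_def by (rule test_fun_affine[OF \<eta>]) simp
  have "partial i \<psi> = (\<lambda>y. - partial i \<eta> (x - y))"
    unfolding \<psi>_def using partial_affine[OF test_fun_differentiable[OF \<eta>], where a = x and c = "-1"] by auto
  with weak_gradD(5)[OF G \<psi>, of i] show ?thesis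
    by (simp add: partial_conv[OF \<eta> v] conv_def \<psi>_def mult.commute)
qed

lemma weak_grad_mult:
  assumes G: "weak_grad u G" and \<kappa>: "smooth3 \<kappa>"
  shows "weak_grad (\<lambda>x. \<kappa> x * u x) (\<lambda>x. \<kappa> x *\<^sub>R G x + u x *\<^sub>R grad \<kappa> x)"
proof (rule weak_gradI)
  note [measurable] = weak_gradD(1,2)[OF G] smooth3_measurable[OF \<kappa>] measurable_grad[OF \<kappa>]
  show "(\<lambda>x. \<kappa> x * u x) \<in> borel_measurable borel"
    "(\<lambda>x. \<kappa> x *\<^sub>R G x + u x *\<^sub>R grad \<kappa> x) \<in> borel_measurable borel"
    by measurable
  show "locally_integrable (\<lambda>x. \<kappa> x * u x)"
    by (intro locally_integrable_mult_continuous smooth3_continuous \<kappa> weak_gradD[OF G])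
  fix i
  have component: "(\<kappa> x *\<^sub>R G x + u x *\<^sub>R grad \<kappa> x) $ i = \<kappa> x * G x $ i + partial i \<kappa> x * u x" for x
    by (simp add: grad_def)
  show "locally_integrable (\<lambda>x. (\<kappa> x *\<^sub>R G x + u x *\<^sub>R grad \<kappa> x) $ i)"
    unfolding component
    by (intro locally_integrable_add locally_integrable_mult_continuous smooth3_continuous
        smooth3_partial \<kappa> weak_gradD[OF G])
  fix \<psi> assume \<psi>: "test_fun \<psi>"
  have \<kappa>\<psi>: "test_fun (\<lambda>x. \<kappa> x * \<psi> x)"
    using \<kappa> \<psi> by (rule test_fun_mult)
  have partial_\<kappa>\<psi>: "partial i (\<lambda>x. \<kappa> x * \<psi> x) x = partial i \<kappa> x * \<psi> x + \<kappa> x * partial i \<psi> x" for x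
    using \<kappa> \<psi> by (intro partial_mult smooth3_differentiable test_fun_differentiable)
  have int: "integrable lborel (\<lambda>x. g x * u x)" "integrable lborel (\<lambda>x. g x * G x $ i)" if "test_fun g" for g
    using test_fun_Cc[OF that] weak_gradD[OF G] by (auto intro: Cc_mult_integrable)
  have "(\<integral>x. (\<kappa> x * u x) * partial i \<psi> x \<partial>lborel)
      = (\<integral>x. partial i (\<lambda>x. \<kappa> x * \<psi> x) x * u x - (partial i \<kappa> x * \<psi> x) * u x \<partial>lborel)"
    by (rule Bochner_Integration.integral_cong) (auto simp: partial_\<kappa>\<psi> algebra_simps)
  also have "\<dots> = - (\<integral>x. (\<kappa> x * \<psi> x) * G x $ i + (partial i \<kappa> x * \<psi> x) * u x \<partial>lborel)"
    using int(1)[OF test_fun_partial[OF \<kappa>\<psi>]] int(1)[OF test_fun_mult[OF smooth3_partial[OF \<kappa>] \<psi>]]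
      int(2)[OF \<kappa>\<psi>] weak_gradD(5)[OF G \<kappa>\<psi>, of i]
    by (simp add: mult.commute)
  also have "(\<integral>x. (\<kappa> x * \<psi> x) * G x $ i + (partial i \<kappa> x * \<psi> x) * u x \<partial>lborel)
      = (\<integral>x. (\<kappa> x *\<^sub>R G x + u x *\<^sub>R grad \<kappa> x) $ i * \<psi> x \<partial>lborel)"
    unfolding component by (rule Bochner_Integration.integral_cong) (auto simp: algebra_simps)
  finally show "(\<integral>x. (\<kappa> x * u x) * partial i \<psi> x \<partial>lborel)
      = - (\<integral>x. (\<kappa> x *\<^sub>R G x + u x *\<^sub>R grad \<kappa> x) $ i * \<psi> x \<partial>lborel)" .
qed

section \<open>A Hardy inequality\<close>

abbreviation dirichlet :: "(R3 \<Rightarrow> R3) \<Rightarrow> real" where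
  "dirichlet G \<equiv> \<integral>x. (norm (G x))\<^sup>2 \<partial>lborel"

text \<open>The claim is \<open>0 \<le> \<integral> (\<partial>\<^sub>i\<psi> + F \<psi>)\<^sup>2\<close>, integrated by parts.\<close>
lemma integral_partial_power2_ge:
  assumes F: "smooth3 F" and \<psi>: "test_fun \<psi>"
  shows "(\<integral>x. (partial i F x - (F x)\<^sup>2) * (\<psi> x)\<^sup>2 \<partial>lborel) \<le> (\<integral>x. (partial i \<psi> x)\<^sup>2 \<partial>lborel)"
proof -
  let ?D = "partial i (\<lambda>x. \<psi> x * \<psi> x)"
  have \<psi>\<psi>: "test_fun (\<lambda>x. \<psi> x * \<psi> x)"
    by (intro test_fun_mult test_fun_smooth3 \<psi>)
  have D: "?D x = 2 * \<psi> x * partial i \<psi> x" for x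
    by (simp add: partial_mult test_fun_differentiable[OF \<psi>])
  have int: "integrable lborel (\<lambda>x. F x * ?D x)" "integrable lborel (\<lambda>x. (F x)\<^sup>2 * (\<psi> x * \<psi> x))"
    "integrable lborel (\<lambda>x. partial i F x * (\<psi> x * \<psi> x))"
    by (intro test_fun_integrable test_fun_mult[OF _ \<psi>\<psi>] test_fun_mult[OF _ test_fun_partial[OF \<psi>\<psi>]]
        smooth3_power smooth3_partial F)+
  have "0 \<le> (\<integral>x. (partial i \<psi> x + F x * \<psi> x)\<^sup>2 \<partial>lborel)"
    by simp
  also have "\<dots> = (\<integral>x. (partial i \<psi> x)\<^sup>2 + F x * ?D x + (F x)\<^sup>2 * (\<psi> x * \<psi> x) \<partial>lborel)"
    by (rule Bochner_Integration.integral_cong) (auto simp: D power2_eq_square algebra_simps)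
  also have "\<dots> = (\<integral>x. (partial i \<psi> x)\<^sup>2 \<partial>lborel) -
      ((\<integral>x. partial i F x * (\<psi> x * \<psi> x) \<partial>lborel) - (\<integral>x. (F x)\<^sup>2 * (\<psi> x * \<psi> x) \<partial>lborel))"
    using int integrable_partial_power2[OF \<psi>] by (simp add: integral_by_parts_test_fun[OF F \<psi>\<psi>])
  also have "(\<integral>x. partial i F x * (\<psi> x * \<psi> x) \<partial>lborel) - (\<integral>x. (F x)\<^sup>2 * (\<psi> x * \<psi> x) \<partial>lborel)
      = (\<integral>x. (partial i F x - (F x)\<^sup>2) * (\<psi> x)\<^sup>2 \<partial>lborel)"
    using int by (simp add: left_diff_distrib power2_eq_square[of "\<psi> _"])
  finally show ?thesis by simp
qed

lemma integral_grad_power2_ge: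
  assumes F: "\<And>i. smooth3 (F i)" and \<psi>: "test_fun \<psi>"
  shows "(\<integral>x. (\<Sum>i\<in>UNIV. partial i (F i) x - (F i x)\<^sup>2) * (\<psi> x)\<^sup>2 \<partial>lborel) \<le> dirichlet (grad \<psi>)"
proof -
  have int: "integrable lborel (\<lambda>x. (partial i (F i) x - (F i x)\<^sup>2) * (\<psi> x)\<^sup>2)" for i
    unfolding power2_eq_square
    by (intro test_fun_integrable test_fun_mult smooth3_diff smooth3_mult smooth3_partial test_fun_smooth3 F \<psi>)
  have "(\<integral>x. (\<Sum>i\<in>UNIV. partial i (F i) x - (F i x)\<^sup>2) * (\<psi> x)\<^sup>2 \<partial>lborel)
      = (\<Sum>i\<in>UNIV. \<integral>x. (partial i (F i) x - (F i x)\<^sup>2) * (\<psi> x)\<^sup>2 \<partial>lborel)"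
    unfolding sum_distrib_right using int by (intro Bochner_Integration.integral_sum)
  also have "\<dots> \<le> (\<Sum>i\<in>UNIV. \<integral>x. (partial i \<psi> x)\<^sup>2 \<partial>lborel)"
    by (intro sum_mono integral_partial_power2_ge F \<psi>)
  also have "\<dots> = dirichlet (grad \<psi>)"
    unfolding norm_grad_power2 using integrable_partial_power2[OF \<psi>]
    by (simp add: Bochner_Integration.integral_sum)
  finally show ?thesis .
qed

definition hardy_weight :: "R3 \<Rightarrow> real" where
  "hardy_weight x = 3 / (1 + (norm x)\<^sup>2)\<^sup>2"

lemma hardy_weight_pos: "0 < hardy_weight x"
  unfolding hardy_weight_def by (intro divide_pos_pos zero_less_power add_pos_nonneg) auto

lemma hardy_weight_vector_field:
  obtains F :: "3 \<Rightarrow> R3 \<Rightarrow> real" where "\<And>i. smooth3 (F i)"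
    "\<And>x. (\<Sum>i\<in>UNIV. partial i (F i) x - (F i x)\<^sup>2) = hardy_weight x"
proof -
  have pos: "0 < 1 + (norm x)\<^sup>2" for x :: R3
    by (simp add: add_pos_nonneg)
  define w :: "R3 \<Rightarrow> real" where "w x = (1 + (norm x)\<^sup>2) powr - 1" for x
  have w: "w x = 1 / (1 + (norm x)\<^sup>2)" for x
    using pos[of x] by (simp add: w_def powr_minus_divide)
  have smooth_w: "smooth3 w"
    unfolding w_def[abs_def] by (intro smooth3_powr smooth3_add smooth3_const smooth3_norm_power2 pos)
  have partial_w: "partial i w x = - 2 * x $ i * (w x)\<^sup>2" for i x
  proof -
    have "((\<lambda>t. 1 / (1 + t)) has_real_derivative - (w x)\<^sup>2) (at ((norm x)\<^sup>2))"
      using pos[of x] by (auto intro!: derivative_eq_intros simp: w power2_eq_square)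
    from partial_comp[OF this smooth3_differentiable[OF smooth3_norm_power2]]
    show ?thesis by (simp add: w[abs_def] partial_norm_power2)
  qed
  define F where "F i x = x $ i * w x" for i and x :: R3
  have partial_F: "partial i (F i) x = w x - 2 * (x $ i)\<^sup>2 * (w x)\<^sup>2" for i x
    unfolding F_def[abs_def]
    by (simp add: partial_mult smooth3_component smooth_w smooth3_differentiable partial_component
        partial_w power2_eq_square)
  have "(\<Sum>i\<in>UNIV. partial i (F i) x - (F i x)\<^sup>2) = hardy_weight x" for x
  proof -
    have "(\<Sum>i\<in>UNIV. partial i (F i) x - (F i x)\<^sup>2) = (\<Sum>i\<in>UNIV. w x - 3 * (w x)\<^sup>2 * (x $ i)\<^sup>2)"
      by (intro sum.cong) (auto simp: partial_F F_def power_mult_distrib)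
    also have "\<dots> = 3 * (w x - (w x)\<^sup>2 * (norm x)\<^sup>2)"
      by (simp add: sum_subtractf norm_vec_power2 sum_distrib_left mult.assoc)
    also have "w x - (w x)\<^sup>2 * (norm x)\<^sup>2 = w x * (1 - w x * (norm x)\<^sup>2)"
      by (simp add: power2_eq_square algebra_simps)
    also have "1 - w x * (norm x)\<^sup>2 = w x"
      using pos[of x] by (simp add: w field_simps)
    finally show ?thesis
      by (simp add: w hardy_weight_def power2_eq_square)
  qed
  moreover have "smooth3 (F i)" for i
    unfolding F_def[abs_def] by (intro smooth3_mult smooth3_component smooth_w)
  ultimately show ?thesis by (intro that)
qed

lemma hardy_test_fun:
  assumes \<psi>: "test_fun \<psi>"
  shows "integrable lborel (\<lambda>x. hardy_weight x * (\<psi> x)\<^sup>2)"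
    and "(\<integral>x. hardy_weight x * (\<psi> x)\<^sup>2 \<partial>lborel) \<le> dirichlet (grad \<psi>)"
proof -
  obtain F where F: "\<And>i::3. smooth3 (F i)" "\<And>x. (\<Sum>i\<in>UNIV. partial i (F i) x - (F i x)\<^sup>2) = hardy_weight x"
    using hardy_weight_vector_field by blast
  have "smooth3 (\<lambda>x. \<Sum>i\<in>UNIV. partial i (F i) x - (F i x)\<^sup>2)"
    by (intro smooth3_sum smooth3_diff smooth3_power smooth3_partial F(1))
  then have weight: "smooth3 hardy_weight"
    by (simp add: F(2))
  show "integrable lborel (\<lambda>x. hardy_weight x * (\<psi> x)\<^sup>2)"
    unfolding power2_eq_square
    by (intro test_fun_integrable test_fun_mult[OF weight] test_fun_mult[OF test_fun_smooth3] \<psi>)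
  show "(\<integral>x. hardy_weight x * (\<psi> x)\<^sup>2 \<partial>lborel) \<le> dirichlet (grad \<psi>)"
    using integral_grad_power2_ge[of F, OF F(1) \<psi>] by (simp add: F(2))
qed

lemma D12_grad_eq_0:
  assumes D: "D12_grad \<phi> G" and G: "dirichlet G = 0"
  shows "AE x in lborel. \<phi> x = 0"
proof -
  obtain \<psi> where \<psi>: "\<And>n. test_fun (\<psi> n)" "AE x in lborel. (\<lambda>n. \<psi> n x) \<longlonglongrightarrow> \<phi> x"
    "(\<lambda>n. \<integral>x. (norm (grad (\<psi> n) x - G x))\<^sup>2 \<partial>lborel) \<longlonglongrightarrow> 0"
    using D by (auto simp: D12_grad_def)
  have "weak_grad \<phi> G" and L2: "integrable lborel (\<lambda>x. (norm (G x))\<^sup>2)"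
    using D by (simp_all add: D12_grad_def L2vec_def)
  note [measurable] = weak_gradD(1,2)[OF this(1)] measurable_grad[OF test_fun_smooth3[OF \<psi>(1)]]
  have G_zero: "AE x in lborel. G x = 0"
    using G integral_nonneg_eq_0_iff_AE[OF L2] by simp
  have [measurable]: "hardy_weight \<in> borel_measurable borel"
    unfolding hardy_weight_def[abs_def] by measurable
  have "(\<integral>x. (norm (grad (\<psi> n) x - G x))\<^sup>2 \<partial>lborel) = dirichlet (grad (\<psi> n))" for n
    using G_zero by (intro integral_cong_AE) auto
  with \<psi>(3) have grad_tendsto: "(\<lambda>n. dirichlet (grad (\<psi> n))) \<longlonglongrightarrow> 0" by simp
  have pos: "AE x in lborel. 0 \<le> hardy_weight x * (\<psi> n x)\<^sup>2" for n
    by (simp add: hardy_weight_pos less_imp_le)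
  have lim: "AE x in lborel. (\<lambda>n. hardy_weight x * (\<psi> n x)\<^sup>2) \<longlonglongrightarrow> hardy_weight x * (\<phi> x)\<^sup>2"
    using \<psi>(2) by eventually_elim (intro tendsto_intros)
  have "(\<lambda>x. hardy_weight x * (\<phi> x)\<^sup>2) \<in> borel_measurable lborel"
    by measurable
  note Fatou = integral_Fatou[OF hardy_test_fun(1)[OF \<psi>(1)] pos this lim
      hardy_test_fun(2)[OF \<psi>(1)] grad_tendsto]
  have nonneg: "AE x in lborel. 0 \<le> hardy_weight x * (\<phi> x)\<^sup>2"
    by (simp add: hardy_weight_pos less_imp_le)
  have "(\<integral>x. hardy_weight x * (\<phi> x)\<^sup>2 \<partial>lborel) = 0"
    using Fatou(2) integral_nonneg_AE[OF nonneg] by simp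
  then have "AE x in lborel. hardy_weight x * (\<phi> x)\<^sup>2 = 0"
    by (simp add: integral_nonneg_eq_0_iff_AE[OF Fatou(1) nonneg])
  then show ?thesis
    using hardy_weight_pos by (auto simp: less_imp_neq[symmetric])
qed

section \<open>Approximation by test functions\<close>

lemma H1_gradD:
  assumes "H1_grad u G"
  shows "weak_grad u G" "integrable lborel (\<lambda>x. (u x)\<^sup>2)" "L2vec G"
  using assms by (auto simp: H1_grad_def L2_def)

lemma L2vecD:
  assumes "L2vec G"
  shows "G \<in> borel_measurable borel" "integrable lborel (\<lambda>x. (norm (G x))\<^sup>2)"
  using assms by (auto simp: L2vec_def)

lemma measurable_component:
  assumes [measurable]: "G \<in> borel_measurable M"
  shows "(\<lambda>x. (G x :: real ^ 'n) $ i) \<in> borel_measurable M"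
  unfolding cart_eq_inner_axis by measurable

lemma
  assumes G: "L2vec G"
  shows integrable_component_power2: "integrable lborel (\<lambda>x. (G x $ i)\<^sup>2)"
    and integral_norm_power2_eq_sum: "dirichlet G = (\<Sum>i\<in>UNIV. \<integral>x. (G x $ i)\<^sup>2 \<partial>lborel)"
proof -
  note [measurable] = measurable_component[OF L2vecD(1)[OF G]]
  show int: "integrable lborel (\<lambda>x. (G x $ i)\<^sup>2)" for i
    by (rule Bochner_Integration.integrable_bound[OF L2vecD(2)[OF G]])
       (auto simp: norm_vec_power2 abs_of_nonneg sum_nonneg intro!: member_le_sum)
  then show "dirichlet G = (\<Sum>i\<in>UNIV. \<integral>x. (G x $ i)\<^sup>2 \<partial>lborel)"
    by (simp add: norm_vec_power2)
qed

lemma integral_grad_conv_le: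
  assumes \<eta>: "mollifier \<eta>" "test_fun \<eta>"
    and v: "weak_grad v G" "bounded {x. v x \<noteq> 0}" and G: "L2vec G"
  shows "dirichlet (grad (conv \<eta> v)) \<le> dirichlet G"
proof -
  have int: "integrable lborel v"
    using weak_gradD(3)[OF v(1)] v(2) by (rule locally_integrable_bounded_support)
  have conv_component: "integrable lborel (\<lambda>x. (conv \<eta> (\<lambda>y. G y $ i) x)\<^sup>2)"
    "(\<integral>x. (conv \<eta> (\<lambda>y. G y $ i) x)\<^sup>2 \<partial>lborel) \<le> (\<integral>x. (G x $ i)\<^sup>2 \<partial>lborel)" for i
    using integrable_conv_power2[OF \<eta>(1)] integral_conv_power2_le[OF \<eta>(1)]
      measurable_component[OF L2vecD(1)[OF G]] integrable_component_power2[OF G] by auto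
  have "dirichlet (grad (conv \<eta> v)) = (\<Sum>i\<in>UNIV. \<integral>x. (conv \<eta> (\<lambda>y. G y $ i) x)\<^sup>2 \<partial>lborel)"
    using conv_component(1) by (simp add: norm_grad_power2 partial_conv_weak_grad[OF \<eta>(2) int v(1)])
  also have "\<dots> \<le> dirichlet G"
    unfolding integral_norm_power2_eq_sum[OF G] by (intro sum_mono conv_component)
  finally show ?thesis .
qed

lemma test_fun_approx_weak_grad:
  assumes v: "weak_grad v G" "bounded {x. v x \<noteq> 0}" and G: "L2vec G"
  obtains g where "\<And>n::nat. test_fun (g n)" "AE x in lborel. (\<lambda>n. g n x) \<longlonglongrightarrow> v x"
    "\<And>n. dirichlet (grad (g n)) \<le> dirichlet G"
proof -
  obtain \<eta> where \<eta>: "approximate_identity \<eta>" "\<And>n. test_fun (\<eta> n)"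
    using approximate_identity_exists by blast
  note mollifier = approximate_identity_mollifier[OF \<eta>(1)]
  have int: "integrable lborel v"
    using weak_gradD(3)[OF v(1)] v(2) by (rule locally_integrable_bounded_support)
  have "(\<lambda>n. \<integral>x. norm (conv (\<eta> n) v x - v x) \<partial>lborel) \<longlonglongrightarrow> 0"
    using approximate_identity_L1[OF \<eta>(1) int] by simp
  from tendsto_L1_AE_subseq[OF _ this] obtain r
    where "AE x in lborel. (\<lambda>n. conv (\<eta> (r n)) v x - v x) \<longlonglongrightarrow> 0"
    using integrable_conv[OF mollifier int] int by auto
  then have "AE x in lborel. (\<lambda>n. conv (\<eta> (r n)) v x) \<longlonglongrightarrow> v x"
    by eventually_elim (rule LIM_zero_cancel)
  then show ?thesis
    using test_fun_conv[OF \<eta>(2) int v(2)] integral_grad_conv_le[OF mollifier \<eta>(2) v G] by (intro that)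
qed

definition smooth_abs :: "real \<Rightarrow> real \<Rightarrow> real" where
  "smooth_abs \<delta> t = sqrt (\<delta>\<^sup>2 + t\<^sup>2) - \<delta>"

lemma smooth_abs_nonneg: "0 \<le> smooth_abs \<delta> t"
  using real_sqrt_le_mono[of "\<delta>\<^sup>2" "\<delta>\<^sup>2 + t\<^sup>2"] by (simp add: smooth_abs_def)

lemma smooth_abs_tendsto:
  assumes "(\<delta> \<longlongrightarrow> 0) F" "(g \<longlongrightarrow> t) F"
  shows "((\<lambda>n. smooth_abs (\<delta> n) (g n)) \<longlongrightarrow> \<bar>t\<bar>) F"
proof -
  have "((\<lambda>n. smooth_abs (\<delta> n) (g n)) \<longlongrightarrow> sqrt (0\<^sup>2 + t\<^sup>2) - 0) F"
    unfolding smooth_abs_def by (intro tendsto_intros assms)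
  then show ?thesis by simp
qed

lemma
  assumes g: "test_fun g" and \<delta>: "\<delta> > 0"
  shows test_fun_smooth_abs: "test_fun (\<lambda>x. smooth_abs \<delta> (g x))"
    and norm_grad_smooth_abs_le: "(norm (grad (\<lambda>x. smooth_abs \<delta> (g x)) x))\<^sup>2 \<le> (norm (grad g x))\<^sup>2"
proof -
  have pos: "0 < \<delta>\<^sup>2 + t\<^sup>2" for t
    using \<delta> by (simp add: add_pos_nonneg)
  have "smooth3 (\<lambda>x. (\<delta>\<^sup>2 + (g x)\<^sup>2) powr (1 / 2) - \<delta>)"
    using pos
    by (intro smooth3_diff smooth3_powr smooth3_add smooth3_const smooth3_power test_fun_smooth3[OF g])
  then have "smooth3 (\<lambda>x. smooth_abs \<delta> (g x))"
    using pos by (simp add: smooth_abs_def powr_half_sqrt less_imp_le)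
  moreover have "{x. smooth_abs \<delta> (g x) \<noteq> 0} \<subseteq> {x. g x \<noteq> 0}"
    using \<delta> by (auto simp: smooth_abs_def)
  ultimately show "test_fun (\<lambda>x. smooth_abs \<delta> (g x))"
    using g by (auto simp: test_fun_iff intro: bounded_subset)
  let ?q = "g x / sqrt (\<delta>\<^sup>2 + (g x)\<^sup>2)"
  have "(smooth_abs \<delta> has_real_derivative ?q) (at (g x))"
    unfolding smooth_abs_def[abs_def] using pos[of "g x"]
    by (auto intro!: derivative_eq_intros simp: field_simps)
  from partial_comp[OF this test_fun_differentiable[OF g]]
  have "(norm (grad (\<lambda>x. smooth_abs \<delta> (g x)) x))\<^sup>2 = ?q\<^sup>2 * (norm (grad g x))\<^sup>2"
    by (simp add: norm_grad_power2 power_mult_distrib power_divide sum_distrib_left)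
  also have "?q\<^sup>2 \<le> 1"
    using pos[of "g x"] by (simp add: power_divide)
  then have "?q\<^sup>2 * (norm (grad g x))\<^sup>2 \<le> (norm (grad g x))\<^sup>2"
    by (rule mult_left_le_one_le[rotated 2]) auto
  finally show "(norm (grad (\<lambda>x. smooth_abs \<delta> (g x)) x))\<^sup>2 \<le> (norm (grad g x))\<^sup>2" .
qed

lemma test_fun_approx_abs:
  assumes v: "weak_grad v G" "bounded {x. v x \<noteq> 0}" and G: "L2vec G"
  obtains \<psi> where "\<And>n::nat. test_fun (\<psi> n)" "\<And>n x. 0 \<le> \<psi> n x"
    "AE x in lborel. (\<lambda>n. \<psi> n x) \<longlonglongrightarrow> \<bar>v x\<bar>"
    "\<And>n. dirichlet (grad (\<psi> n)) \<le> dirichlet G"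
proof -
  obtain g where g: "\<And>n::nat. test_fun (g n)" "AE x in lborel. (\<lambda>n. g n x) \<longlonglongrightarrow> v x"
    and grad_le: "\<And>n. dirichlet (grad (g n)) \<le> dirichlet G"
    by (rule test_fun_approx_weak_grad[OF v G]) (rule that)
  define \<psi> where "\<psi> n x = smooth_abs (inverse (real (Suc n))) (g n x)" for n x
  have \<psi>: "test_fun (\<psi> n)" for n
    unfolding \<psi>_def[abs_def] by (rule test_fun_smooth_abs[OF g(1)]) simp
  show ?thesis
  proof (rule that[OF \<psi>])
    show "0 \<le> \<psi> n x" for n x
      by (simp add: \<psi>_def smooth_abs_nonneg)
    show "AE x in lborel. (\<lambda>n. \<psi> n x) \<longlonglongrightarrow> \<bar>v x\<bar>"
      using g(2) unfolding \<psi>_def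
      by eventually_elim (rule smooth_abs_tendsto[OF LIMSEQ_inverse_real_of_nat])
    have "dirichlet (grad (\<psi> n)) \<le> dirichlet (grad (g n))" for n
      using integrable_grad_power2[OF \<psi>] integrable_grad_power2[OF g(1)]
      unfolding \<psi>_def[abs_def] by (intro integral_mono norm_grad_smooth_abs_le g(1)) auto
    then show "dirichlet (grad (\<psi> n)) \<le> dirichlet G" for n
      using grad_le by (rule order_trans)
  qed
qed

definition cutoff :: "nat \<Rightarrow> R3 \<Rightarrow> real" where
  "cutoff n x = 1 / bump 0 * bump (inverse (real (Suc n)) *\<^sub>R x)"

lemma test_fun_cutoff: "test_fun (cutoff n)"
  unfolding cutoff_def[abs_def] by (intro test_fun_mult smooth3_const test_fun_scaleR test_fun_bump) simp

lemma cutoff_nonneg: "0 \<le> cutoff n x" and cutoff_le_1: "cutoff n x \<le> 1"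
  using bump_nonneg bump_le bump_0 by (auto simp: cutoff_def)

lemma cutoff_tendsto_1: "(\<lambda>n. cutoff n x) \<longlonglongrightarrow> 1"
proof -
  have "isCont bump (0 *\<^sub>R x)"
    by (rule differentiable_imp_continuous_within[OF smooth3_differentiable[OF smooth3_bump]])
  moreover have "(\<lambda>n. inverse (real (Suc n)) *\<^sub>R x) \<longlonglongrightarrow> 0 *\<^sub>R x"
    by (intro tendsto_intros LIMSEQ_inverse_real_of_nat)
  ultimately have "(\<lambda>n. bump (inverse (real (Suc n)) *\<^sub>R x)) \<longlonglongrightarrow> bump (0 *\<^sub>R x)"
    by (rule isCont_tendsto_compose)
  then have "(\<lambda>n. cutoff n x) \<longlonglongrightarrow> 1 / bump 0 * bump (0 *\<^sub>R x)"
    unfolding cutoff_def by (intro tendsto_intros)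
  then show ?thesis using bump_0 by simp
qed

lemma grad_cutoff:
  "grad (cutoff n) x = (1 / bump 0 * inverse (real (Suc n))) *\<^sub>R grad bump (inverse (real (Suc n)) *\<^sub>R x)"
proof -
  have "partial i (cutoff n) x
      = 1 / bump 0 * inverse (real (Suc n)) * partial i bump (inverse (real (Suc n)) *\<^sub>R x)" for i
    unfolding cutoff_def[abs_def]
    using smooth3_differentiable[OF smooth3_bump] differentiable_affine[of bump 0 _ x] partial_affine[of bump 0 _ x i]
    by (subst partial_mult) (simp_all add: partial_const del: of_nat_Suc)
  then show ?thesis
    by (simp add: grad_def vec_eq_iff)
qed

lemma norm_grad_cutoff_le:
  obtains C where "\<And>n x. norm (grad (cutoff n) x) \<le> C * inverse (real (Suc n))"
proof -
  obtain B where B: "\<And>x. norm (grad bump x) \<le> B"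
    using test_fun_grad_bounded[OF test_fun_bump] by blast
  have "norm (grad (cutoff n) x) \<le> (1 / bump 0 * B) * inverse (real (Suc n))" for n x
    unfolding grad_cutoff norm_scaleR
    using mult_left_mono[OF B, of "1 / bump 0 * inverse (real (Suc n))"] bump_0
    by (simp add: mult.commute mult.left_commute del: of_nat_Suc)
  then show ?thesis by (rule that)
qed

lemma grad_cutoff_bounded:
  obtains C where "\<And>n x. norm (grad (cutoff n) x) \<le> C"
proof -
  obtain C where C: "\<And>n x. norm (grad (cutoff n) x) \<le> C * inverse (real (Suc n))"
    using norm_grad_cutoff_le by blast
  have "0 \<le> C"
    using order_trans[OF norm_ge_zero C[of 0 0]] by simp
  then have "C * inverse (real (Suc n)) \<le> C * 1" for n
    by (intro mult_left_mono) (simp_all add: field_simps)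
  then have "norm (grad (cutoff n) x) \<le> C * 1" for n x
    using C by (rule order_trans[rotated])
  then show ?thesis by (rule that)
qed

lemma grad_cutoff_tendsto_0: "(\<lambda>n. grad (cutoff n) x) \<longlonglongrightarrow> 0"
proof -
  obtain C where C: "\<And>n x. norm (grad (cutoff n) x) \<le> C * inverse (real (Suc n))"
    using norm_grad_cutoff_le by blast
  have "(\<lambda>n. C * inverse (real (Suc n))) \<longlonglongrightarrow> C * 0"
    by (intro tendsto_intros LIMSEQ_inverse_real_of_nat)
  then have "(\<lambda>n. C * inverse (real (Suc n))) \<longlonglongrightarrow> 0"
    by simp
  then show ?thesis
    by (rule Lim_null_comparison[rotated]) (intro always_eventually allI C)
qed

lemma norm_scaleR_add_power2_le:
  fixes a b :: "'a::real_normed_vector"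
  assumes "0 \<le> k" "k \<le> 1" "norm b \<le> C"
  shows "(norm (k *\<^sub>R a + t *\<^sub>R b))\<^sup>2 \<le> 2 * (norm a)\<^sup>2 + 2 * C\<^sup>2 * t\<^sup>2"
proof -
  have "norm (k *\<^sub>R a + t *\<^sub>R b) \<le> norm a + C * \<bar>t\<bar>"
    using assms
    by (intro order_trans[OF norm_triangle_ineq] add_mono)
       (auto simp: mult.commute[of C] intro!: mult_left_mono mult_left_le_one_le)
  then have "(norm (k *\<^sub>R a + t *\<^sub>R b))\<^sup>2 \<le> (norm a + C * \<bar>t\<bar>)\<^sup>2"
    by (intro power_mono) auto
  also have "\<dots> \<le> 2 * (norm a)\<^sup>2 + 2 * C\<^sup>2 * t\<^sup>2"
    using zero_le_power2[of "norm a - C * \<bar>t\<bar>"] by (simp add: power2_sum power2_diff power_mult_distrib)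
  finally show ?thesis .
qed

lemma cutoff_dirichlet_tendsto:
  assumes v: "H1_grad v G"
  defines "H n x \<equiv> cutoff n x *\<^sub>R G x + v x *\<^sub>R grad (cutoff n) x"
  shows "L2vec (H n)" and "(\<lambda>n. dirichlet (H n)) \<longlonglongrightarrow> dirichlet G"
proof -
  obtain C where C: "\<And>n x. norm (grad (cutoff n) x) \<le> C"
    using grad_cutoff_bounded by blast
  note [measurable] = weak_gradD(1,2)[OF H1_gradD(1)[OF v]] test_fun_measurable[OF test_fun_cutoff]
    measurable_grad[OF test_fun_smooth3[OF test_fun_cutoff]]
  have [measurable]: "H n \<in> borel_measurable borel" for n
    unfolding H_def[abs_def] by measurable
  let ?w = "\<lambda>x. 2 * (norm (G x))\<^sup>2 + 2 * C\<^sup>2 * (v x)\<^sup>2"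
  have w: "integrable lborel ?w"
    using H1_gradD[OF v] by (simp add: L2vec_def)
  have bound: "(norm (H n x))\<^sup>2 \<le> ?w x" for n x
    unfolding H_def by (intro norm_scaleR_add_power2_le cutoff_nonneg cutoff_le_1 C)
  have "integrable lborel (\<lambda>x. (norm (H n x))\<^sup>2)"
    by (rule Bochner_Integration.integrable_bound[OF w]) (use order_trans[OF bound abs_ge_self] in auto)
  then show "L2vec (H n)"
    by (simp add: L2vec_def)
  have H_tendsto: "(\<lambda>n. (norm (H n x))\<^sup>2) \<longlonglongrightarrow> (norm (1 *\<^sub>R G x + v x *\<^sub>R 0))\<^sup>2" for x
    unfolding H_def by (intro tendsto_intros cutoff_tendsto_1 grad_cutoff_tendsto_0)
  show "(\<lambda>n. dirichlet (H n)) \<longlonglongrightarrow> dirichlet G"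
  proof (rule integral_dominated_convergence[OF _ _ w])
    show "AE x in lborel. (\<lambda>n. (norm (H n x))\<^sup>2) \<longlonglongrightarrow> (norm (G x))\<^sup>2"
      using H_tendsto by simp
    show "AE x in lborel. norm ((norm (H n x))\<^sup>2) \<le> ?w x" for n
      using bound by simp
  qed auto
qed

section \<open>Weak solutions of Poisson's equation\<close>

lemma integral_density_abs_le_bounded_support:
  assumes \<rho>: "\<rho> \<in> borel_measurable borel" "locally_integrable \<rho>" "\<And>x. 0 \<le> \<rho> x"
    and test: "\<And>\<psi>. test_fun \<psi> \<Longrightarrow> (\<integral>x. \<rho> x * \<psi> x \<partial>lborel) \<le> dirichlet (grad \<psi>) + A"
    and v: "weak_grad v G" "bounded {x. v x \<noteq> 0}" "L2vec G"
  shows "integrable lborel (\<lambda>x. \<rho> x * \<bar>v x\<bar>)"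
    and "(\<integral>x. \<rho> x * \<bar>v x\<bar> \<partial>lborel) \<le> dirichlet G + A"
proof -
  obtain \<psi> where \<psi>: "\<And>n::nat. test_fun (\<psi> n)" "\<And>n x. 0 \<le> \<psi> n x"
    "AE x in lborel. (\<lambda>n. \<psi> n x) \<longlonglongrightarrow> \<bar>v x\<bar>"
    "\<And>n. dirichlet (grad (\<psi> n)) \<le> dirichlet G"
    by (rule test_fun_approx_abs[OF v]) (rule that)
  note [measurable] = \<rho>(1) weak_gradD(1)[OF v(1)]
  have int: "integrable lborel (\<lambda>x. \<rho> x * \<psi> n x)" for n
    using Cc_mult_integrable[OF test_fun_Cc[OF \<psi>(1)] \<rho>(2)] by (simp add: mult.commute)
  have nonneg: "AE x in lborel. 0 \<le> \<rho> x * \<psi> n x" for n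
    using \<rho>(3) \<psi>(2) by simp
  have lim: "AE x in lborel. (\<lambda>n. \<rho> x * \<psi> n x) \<longlonglongrightarrow> \<rho> x * \<bar>v x\<bar>"
    using \<psi>(3) by eventually_elim (intro tendsto_intros)
  have le: "(\<integral>x. \<rho> x * \<psi> n x \<partial>lborel) \<le> dirichlet G + A" for n
    using test[OF \<psi>(1)[of n]] \<psi>(4)[of n] by linarith
  show "integrable lborel (\<lambda>x. \<rho> x * \<bar>v x\<bar>)"
    and "(\<integral>x. \<rho> x * \<bar>v x\<bar> \<partial>lborel) \<le> dirichlet G + A"
    by (rule integral_Fatou[OF int nonneg _ lim le tendsto_const], measurable)+
qed

text \<open>Fatou's lemma yields the integrability of \<open>\<rho> \<bar>v\<bar>\<close> as well, so the Sobolev embedding is not needed.\<close>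
lemma integral_density_abs_le:
  assumes \<rho>: "\<rho> \<in> borel_measurable borel" "locally_integrable \<rho>" "\<And>x. 0 \<le> \<rho> x"
    and test: "\<And>\<psi>. test_fun \<psi> \<Longrightarrow> (\<integral>x. \<rho> x * \<psi> x \<partial>lborel) \<le> dirichlet (grad \<psi>) + A"
    and v: "H1_grad v G"
  shows "integrable lborel (\<lambda>x. \<rho> x * \<bar>v x\<bar>)"
    and "(\<integral>x. \<rho> x * \<bar>v x\<bar> \<partial>lborel) \<le> dirichlet G + A"
proof -
  note [measurable] = \<rho>(1) weak_gradD(1)[OF H1_gradD(1)[OF v]]
  let ?H = "\<lambda>n x. cutoff n x *\<^sub>R G x + v x *\<^sub>R grad (cutoff n) x"
  have "bounded {x. cutoff n x * v x \<noteq> 0}" for n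
    by (rule bounded_subset[of "{x. cutoff n x \<noteq> 0}"]) (use test_fun_cutoff in \<open>auto simp: test_fun_iff\<close>)
  note cutoff_le = integral_density_abs_le_bounded_support[OF \<rho> test
      weak_grad_mult[OF H1_gradD(1)[OF v] test_fun_smooth3[OF test_fun_cutoff]] this
      cutoff_dirichlet_tendsto(1)[OF v]]
  have nonneg: "AE x in lborel. 0 \<le> \<rho> x * \<bar>cutoff n x * v x\<bar>" for n
    using \<rho>(3) by simp
  have "(\<lambda>n. \<rho> x * \<bar>cutoff n x * v x\<bar>) \<longlonglongrightarrow> \<rho> x * \<bar>1 * v x\<bar>" for x
    by (intro tendsto_intros cutoff_tendsto_1)
  then have lim: "AE x in lborel. (\<lambda>n. \<rho> x * \<bar>cutoff n x * v x\<bar>) \<longlonglongrightarrow> \<rho> x * \<bar>v x\<bar>"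
    by simp
  have energy: "(\<lambda>n. dirichlet (?H n) + A) \<longlonglongrightarrow> dirichlet G + A"
    by (intro tendsto_intros cutoff_dirichlet_tendsto[OF v])
  show "integrable lborel (\<lambda>x. \<rho> x * \<bar>v x\<bar>)"
    and "(\<integral>x. \<rho> x * \<bar>v x\<bar> \<partial>lborel) \<le> dirichlet G + A"
    by (rule integral_Fatou[OF cutoff_le(1) nonneg _ lim cutoff_le(2) energy], measurable)+
qed

definition weak_poisson :: "(R3 \<Rightarrow> real) \<Rightarrow> (R3 \<Rightarrow> real) \<Rightarrow> (R3 \<Rightarrow> R3) \<Rightarrow> bool" where
  "weak_poisson \<rho> \<phi> G \<longleftrightarrow> D12_grad \<phi> G \<and>
     (\<forall>\<psi> H. D12_grad \<psi> H \<longrightarrow> (\<integral>x. G x \<bullet> H x \<partial>lborel) = (\<integral>x. \<rho> x * \<psi> x \<partial>lborel))"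

lemma weak_poissonD:
  assumes "weak_poisson \<rho> \<phi> G"
  shows "D12_grad \<phi> G" "L2vec G" "\<phi> \<in> borel_measurable borel"
    "D12_grad \<psi> H \<Longrightarrow> (\<integral>x. G x \<bullet> H x \<partial>lborel) = (\<integral>x. \<rho> x * \<psi> x \<partial>lborel)"
  using assms by (auto simp: weak_poisson_def D12_grad_def dest: weak_gradD)

lemma
  assumes \<phi>: "weak_poisson \<rho> \<phi> G" and [measurable]: "\<rho> \<in> borel_measurable borel"
  shows weak_poisson_integrable: "integrable lborel (\<lambda>x. \<rho> x * \<phi> x)"
    and weak_poisson_energy: "dirichlet G = (\<integral>x. \<rho> x * \<phi> x \<partial>lborel)"
proof -
  note [measurable] = weak_poissonD(3)[OF \<phi>]
  show energy: "dirichlet G = (\<integral>x. \<rho> x * \<phi> x \<partial>lborel)"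
    using weak_poissonD(4)[OF \<phi> weak_poissonD(1)[OF \<phi>]] by (simp add: power2_norm_eq_inner)
  \<comment> \<open>Otherwise the right-hand side is the junk value 0, which forces \<open>\<phi> = 0\<close>.\<close>
  show "integrable lborel (\<lambda>x. \<rho> x * \<phi> x)"
  proof (rule ccontr)
    assume not_int: "\<not> integrable lborel (\<lambda>x. \<rho> x * \<phi> x)"
    with energy have "dirichlet G = 0"
      by (simp add: not_integrable_integral_eq)
    with weak_poissonD(1)[OF \<phi>] have "AE x in lborel. \<phi> x = 0"
      by (rule D12_grad_eq_0)
    then have "AE x in lborel. \<rho> x * \<phi> x = 0"
      by eventually_elim simp
    then have "integrable lborel (\<lambda>x. \<rho> x * \<phi> x) \<longleftrightarrow> integrable lborel (\<lambda>x::R3. 0::real)"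
      by (intro integrable_cong_AE) auto
    with not_int show False by simp
  qed
qed

lemma integrable_inner_L2vec:
  assumes G: "L2vec G" and H: "L2vec H" shows "integrable lborel (\<lambda>x. G x \<bullet> H x)"
proof (rule Bochner_Integration.integrable_bound)
  show "integrable lborel (\<lambda>x. (norm (G x))\<^sup>2 + (norm (H x))\<^sup>2)"
    using L2vecD(2)[OF G] L2vecD(2)[OF H] by simp
  have "\<bar>G x \<bullet> H x\<bar> \<le> (norm (G x))\<^sup>2 + (norm (H x))\<^sup>2" for x
  proof -
    have "2 * \<bar>G x \<bullet> H x\<bar> \<le> 2 * (norm (G x) * norm (H x))"
      using Cauchy_Schwarz_ineq2[of "G x" "H x"] by simp
    also have "\<dots> \<le> (norm (G x))\<^sup>2 + (norm (H x))\<^sup>2"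
      using zero_le_power2[of "norm (G x) - norm (H x)"] by (simp add: power2_diff)
    finally show ?thesis by simp
  qed
  then show "AE x in lborel. norm (G x \<bullet> H x) \<le> norm ((norm (G x))\<^sup>2 + (norm (H x))\<^sup>2)"
    by (auto intro: order_trans[OF _ abs_ge_self])
qed (use L2vecD(1)[OF G] L2vecD(1)[OF H] in measurable)

text \<open>Expand \<open>0 \<le> \<integral> \<bar>\<nabla>\<psi> - (t/2) \<nabla>\<phi>\<bar>\<^sup>2\<close>.\<close>
lemma weak_poisson_test_fun_le:
  assumes \<phi>: "weak_poisson \<rho> \<phi> G" and \<psi>: "test_fun \<psi>"
  shows "t * (\<integral>x. \<rho> x * \<psi> x \<partial>lborel)
    \<le> dirichlet (grad \<psi>) + t\<^sup>2 / 4 * dirichlet G"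
proof -
  have D: "D12_grad \<psi> (grad \<psi>)"
    using \<psi> by (rule D12_grad_test_fun)
  have int: "integrable lborel (\<lambda>x. G x \<bullet> grad \<psi> x)"
    "integrable lborel (\<lambda>x. (norm (grad \<psi> x))\<^sup>2)" "integrable lborel (\<lambda>x. (norm (G x))\<^sup>2)"
    using D weak_poissonD(2)[OF \<phi>] by (auto simp: D12_grad_def intro: integrable_inner_L2vec L2vecD)
  have "0 \<le> (\<integral>x. (norm (grad \<psi> x - (t / 2) *\<^sub>R G x))\<^sup>2 \<partial>lborel)"
    by simp
  also have "\<dots> = (\<integral>x. (norm (grad \<psi> x))\<^sup>2 + t\<^sup>2 / 4 * (norm (G x))\<^sup>2 - t * (G x \<bullet> grad \<psi> x) \<partial>lborel)"
    unfolding power2_norm_eq_inner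
    by (intro Bochner_Integration.integral_cong) (auto simp: inner_diff inner_commute power2_eq_square)
  also have "\<dots> = dirichlet (grad \<psi>) + t\<^sup>2 / 4 * dirichlet G
      - t * (\<integral>x. \<rho> x * \<psi> x \<partial>lborel)"
    using int by (simp add: weak_poissonD(4)[OF \<phi> D])
  finally show ?thesis by simp
qed

lemma
  assumes \<phi>: "weak_poisson \<rho> \<phi> G" and v: "H1_grad v H" and t: "t > 0"
    and \<rho>: "\<rho> \<in> borel_measurable borel" "locally_integrable \<rho>" "\<And>x. 0 \<le> \<rho> x"
  shows weak_poisson_integrable_abs: "integrable lborel (\<lambda>x. \<rho> x * \<bar>v x\<bar>)"
    and weak_poisson_abs_le: "t * (\<integral>x. \<rho> x * \<bar>v x\<bar> \<partial>lborel)
      \<le> dirichlet H + t\<^sup>2 / 4 * dirichlet G"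
proof -
  have t\<rho>: "(\<lambda>x. t * \<rho> x) \<in> borel_measurable borel" "locally_integrable (\<lambda>x. t * \<rho> x)" "0 \<le> t * \<rho> x" for x
    using \<rho> t by (auto intro: locally_integrable_mult_continuous)
  have "(\<integral>x. (t * \<rho> x) * \<psi> x \<partial>lborel)
      \<le> dirichlet (grad \<psi>) + t\<^sup>2 / 4 * dirichlet G" if "test_fun \<psi>" for \<psi>
    using weak_poisson_test_fun_le[OF \<phi> that] by (simp add: mult.assoc)
  note le = integral_density_abs_le[OF t\<rho> this v]
  show "integrable lborel (\<lambda>x. \<rho> x * \<bar>v x\<bar>)"
    using le(1) t by (simp add: mult.assoc)
  show "t * (\<integral>x. \<rho> x * \<bar>v x\<bar> \<partial>lborel)
      \<le> dirichlet H + t\<^sup>2 / 4 * dirichlet G"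
    using le(2) by (simp add: mult.assoc)
qed

section \<open>The nonlinearity\<close>

lemma quotient_bounded:
  fixes f :: "real \<Rightarrow> real"
  assumes f: "continuous_on UNIV f"
    and f1: "((\<lambda>s. f s / s) \<longlongrightarrow> 0) at_infinity" and f2: "((\<lambda>s. f s / s) \<longlongrightarrow> 0) (at 0)"
  obtains B where "\<And>s. s \<noteq> 0 \<Longrightarrow> \<bar>f s / s\<bar> \<le> B"
proof -
  have "\<forall>\<^sub>F s in at_infinity. dist (f s / s) 0 < 1"
    using f1 by (rule tendstoD) simp
  then obtain R where R: "\<And>s. R \<le> \<bar>s\<bar> \<Longrightarrow> \<bar>f s / s\<bar> < 1"
    by (auto simp: eventually_at_infinity)
  have "\<forall>\<^sub>F s in at 0. dist (f s / s) 0 < 1"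
    using f2 by (rule tendstoD) simp
  then obtain d where d: "d > 0" "\<And>s. s \<noteq> 0 \<Longrightarrow> \<bar>s\<bar> < d \<Longrightarrow> \<bar>f s / s\<bar> < 1"
    by (auto simp: eventually_at dist_real_def)
  let ?K = "cball (0::real) R - ball 0 d"
  have "compact ?K" by (intro compact_diff) auto
  moreover have "continuous_on ?K (\<lambda>s. f s / s)"
    using d(1) by (intro continuous_intros continuous_on_subset[OF f]) auto
  ultimately have "bounded ((\<lambda>s. f s / s) ` ?K)"
    by (intro compact_imp_bounded compact_continuous_image)
  then obtain B where "\<forall>y\<in>(\<lambda>s. f s / s) ` ?K. norm y \<le> B"
    unfolding bounded_iff by blast
  then have B: "\<bar>f s / s\<bar> \<le> B" if "s \<in> ?K" for s
    using that unfolding real_norm_def by blast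
  have "\<bar>f s / s\<bar> \<le> max 1 B" if "s \<noteq> 0" for s
    using R[of s] d(2)[OF that] B[of s] by (cases "s \<in> ?K") (auto simp: dist_real_def)
  then show ?thesis by (rule that)
qed

lemma bdd_above_c_f:
  assumes e: "e > 0" and f: "continuous_on UNIV f"
    and f1: "((\<lambda>s. f s / s) \<longlongrightarrow> 0) at_infinity" and f2: "((\<lambda>s. f s / s) \<longlongrightarrow> 0) (at 0)"
  shows "bdd_above ((\<lambda>s. \<bar>f s\<bar> / (\<bar>s\<bar> + 4 * sqrt pi * e * s\<^sup>2)) ` (UNIV - {0}))"
proof -
  obtain B where B: "\<And>s. s \<noteq> 0 \<Longrightarrow> \<bar>f s / s\<bar> \<le> B"
    using quotient_bounded[OF f f1 f2] by metis
  have "\<bar>f s\<bar> / (\<bar>s\<bar> + 4 * sqrt pi * e * s\<^sup>2) \<le> B" if "s \<noteq> 0" for s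
  proof -
    have "\<bar>f s\<bar> / (\<bar>s\<bar> + 4 * sqrt pi * e * s\<^sup>2) \<le> \<bar>f s\<bar> / \<bar>s\<bar>"
      using that e by (intro divide_left_mono) (auto intro!: add_pos_nonneg mult_pos_pos)
    with B[OF that] show ?thesis by simp
  qed
  then show ?thesis
    by (intro bdd_aboveI2[of _ _ B]) auto
qed

lemma abs_mult_le_c_f:
  assumes e: "e > 0" and bdd: "bdd_above ((\<lambda>s. \<bar>f s\<bar> / (\<bar>s\<bar> + 4 * sqrt pi * e * s\<^sup>2)) ` (UNIV - {0}))"
  shows "\<bar>f s\<bar> * \<bar>s\<bar> \<le> c_f e f * (s\<^sup>2 + 4 * sqrt pi * e * \<bar>s\<bar> ^ 3)"
proof (cases "s = 0")
  case False
  then have pos: "0 < \<bar>s\<bar> + 4 * sqrt pi * e * s\<^sup>2"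
    using e by (intro add_pos_nonneg) auto
  have "\<bar>f s\<bar> / (\<bar>s\<bar> + 4 * sqrt pi * e * s\<^sup>2) \<le> c_f e f"
    unfolding c_f_def using False by (intro cSUP_upper bdd) auto
  then have "\<bar>f s\<bar> \<le> c_f e f * (\<bar>s\<bar> + 4 * sqrt pi * e * s\<^sup>2)"
    using pos by (simp add: pos_divide_le_eq)
  then have "\<bar>f s\<bar> * \<bar>s\<bar> \<le> c_f e f * (\<bar>s\<bar> + 4 * sqrt pi * e * s\<^sup>2) * \<bar>s\<bar>"
    by (rule mult_right_mono) simp
  also have "\<dots> = c_f e f * (s\<^sup>2 + 4 * sqrt pi * e * \<bar>s\<bar> ^ 3)"
    by (simp add: power3_eq_cube power2_eq_square algebra_simps flip: abs_mult)
  finally show ?thesis .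
qed simp

lemma AE_abs_le_norm_inf:
  assumes "Linf \<alpha>" shows "AE x in lborel. \<bar>\<alpha> x\<bar> \<le> norm_inf \<alpha>"
  using esssup_AE[of "\<lambda>x. ereal \<bar>\<alpha> x\<bar>" lborel]
proof eventually_elim
  case (elim x)
  with assms show ?case
    unfolding Linf_def norm_inf_def by (cases "esssup lborel (\<lambda>x. ereal \<bar>\<alpha> x\<bar>)") auto
qed

lemma integral_nonlinearity_le:
  assumes e: "e > 0" and f [measurable]: "f \<in> borel_measurable borel"
    and bdd: "bdd_above ((\<lambda>s. \<bar>f s\<bar> / (\<bar>s\<bar> + 4 * sqrt pi * e * s\<^sup>2)) ` (UNIV - {0}))"
    and \<alpha>: "Linf \<alpha>" and [measurable]: "u \<in> borel_measurable borel"
    and u: "integrable lborel (\<lambda>x. (u x)\<^sup>2)" "integrable lborel (\<lambda>x. \<bar>u x\<bar> ^ 3)"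
  shows "(\<integral>x. \<alpha> x * f (u x) * u x \<partial>lborel)
    \<le> norm_inf \<alpha> * c_f e f * ((\<integral>x. (u x)\<^sup>2 \<partial>lborel) + 4 * sqrt pi * e * (\<integral>x. \<bar>u x\<bar> ^ 3 \<partial>lborel))"
proof -
  let ?B = "\<lambda>x. norm_inf \<alpha> * c_f e f * ((u x)\<^sup>2 + 4 * sqrt pi * e * \<bar>u x\<bar> ^ 3)"
  have [measurable]: "\<alpha> \<in> borel_measurable borel"
    using \<alpha> by (simp add: Linf_def)
  have bound: "AE x in lborel. \<bar>\<alpha> x * f (u x) * u x\<bar> \<le> ?B x"
    using AE_abs_le_norm_inf[OF \<alpha>]
  proof eventually_elim
    case (elim x)
    have "\<bar>\<alpha> x\<bar> * (\<bar>f (u x)\<bar> * \<bar>u x\<bar>) \<le> norm_inf \<alpha> * (c_f e f * ((u x)\<^sup>2 + 4 * sqrt pi * e * \<bar>u x\<bar> ^ 3))"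
      using elim abs_ge_zero[of "\<alpha> x"] by (intro mult_mono abs_mult_le_c_f[OF e bdd]) auto
    then show ?case by (simp add: abs_mult mult.assoc)
  qed
  have int: "integrable lborel ?B"
    using u by (intro integrable_mult_right Bochner_Integration.integrable_add)
  have "integrable lborel (\<lambda>x. \<alpha> x * f (u x) * u x)"
    by (rule Bochner_Integration.integrable_bound[OF int]) (use bound in auto)
  then have "(\<integral>x. \<alpha> x * f (u x) * u x \<partial>lborel) \<le> (\<integral>x. ?B x \<partial>lborel)"
    using int bound by (intro integral_mono_AE) auto
  also have "\<dots> = norm_inf \<alpha> * c_f e f * ((\<integral>x. (u x)\<^sup>2 \<partial>lborel) + 4 * sqrt pi * e * (\<integral>x. \<bar>u x\<bar> ^ 3 \<partial>lborel))"
    using u by simp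
  finally show ?thesis .
qed

section \<open>Nonexistence of nontrivial solutions\<close>

lemma integral_energy_density:
  assumes u: "H1_grad u Gu" and \<phi>: "weak_poisson (\<lambda>x. 4 * pi * e * (u x)\<^sup>2) \<phi> G\<phi>"
  shows "(\<integral>x. Gu x \<bullet> Gu x + u x * u x + e * \<phi> x * u x * u x \<partial>lborel)
    = dirichlet Gu + (\<integral>x. (u x)\<^sup>2 \<partial>lborel) + dirichlet G\<phi> / (4 * pi)"
proof -
  define \<rho> where "\<rho> x = 4 * pi * e * (u x)\<^sup>2" for x
  have \<phi>': "weak_poisson \<rho> \<phi> G\<phi>"
    using \<phi> by (simp add: \<rho>_def[abs_def])
  note [measurable] = weak_gradD(1)[OF H1_gradD(1)[OF u]]
  have \<rho>: "\<rho> \<in> borel_measurable borel"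
    unfolding \<rho>_def[abs_def] by measurable
  have "(\<integral>x. Gu x \<bullet> Gu x + u x * u x + e * \<phi> x * u x * u x \<partial>lborel)
      = (\<integral>x. (norm (Gu x))\<^sup>2 + (u x)\<^sup>2 + \<rho> x * \<phi> x / (4 * pi) \<partial>lborel)"
    unfolding power2_norm_eq_inner
    by (intro Bochner_Integration.integral_cong) (auto simp: \<rho>_def power2_eq_square)
  also have "\<dots> = dirichlet Gu + (\<integral>x. (u x)\<^sup>2 \<partial>lborel) + (\<integral>x. \<rho> x * \<phi> x \<partial>lborel) / (4 * pi)"
    using H1_gradD(2)[OF u] L2vecD(2)[OF H1_gradD(3)[OF u]] weak_poisson_integrable[OF \<phi>' \<rho>] by simp
  finally show ?thesis
    by (simp add: weak_poisson_energy[OF \<phi>' \<rho>])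
qed

lemma
  assumes e: "e > 0" and u: "H1_grad u Gu" and \<phi>: "weak_poisson (\<lambda>x. 4 * pi * e * (u x)\<^sup>2) \<phi> G\<phi>"
  shows poisson_integrable_cubic: "integrable lborel (\<lambda>x. \<bar>u x\<bar> ^ 3)"
    and poisson_cubic_le: "4 * sqrt pi * e * (\<integral>x. \<bar>u x\<bar> ^ 3 \<partial>lborel) \<le> dirichlet Gu + dirichlet G\<phi> / (4 * pi)"
proof -
  note [measurable] = weak_gradD(1)[OF H1_gradD(1)[OF u]]
  let ?\<rho> = "\<lambda>x. 4 * pi * e * (u x)\<^sup>2"
  have \<rho>: "?\<rho> \<in> borel_measurable borel" "locally_integrable ?\<rho>" "0 \<le> ?\<rho> x" for x
    using H1_gradD(2)[OF u] e by (auto intro: integrable_imp_locally_integrable)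
  have cube: "?\<rho> x * \<bar>u x\<bar> = 4 * pi * e * \<bar>u x\<bar> ^ 3" for x
    by (simp add: power2_eq_square power3_eq_cube flip: abs_mult)
  have t: "0 < 1 / sqrt pi" by simp
  show "integrable lborel (\<lambda>x. \<bar>u x\<bar> ^ 3)"
    using weak_poisson_integrable_abs[OF \<phi> u t \<rho>] e by (simp add: cube)
  have "4 * sqrt pi * e * (\<integral>x. \<bar>u x\<bar> ^ 3 \<partial>lborel) = 4 * (pi / sqrt pi) * e * (\<integral>x. \<bar>u x\<bar> ^ 3 \<partial>lborel)"
    by (simp only: real_div_sqrt pi_ge_zero)
  also have "\<dots> = 1 / sqrt pi * (\<integral>x. ?\<rho> x * \<bar>u x\<bar> \<partial>lborel)"
    by (simp add: cube)
  also have "\<dots> \<le> dirichlet Gu + (1 / sqrt pi)\<^sup>2 / 4 * dirichlet G\<phi>"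
    by (rule weak_poisson_abs_le[OF \<phi> u t \<rho>])
  finally show "4 * sqrt pi * e * (\<integral>x. \<bar>u x\<bar> ^ 3 \<partial>lborel) \<le> dirichlet Gu + dirichlet G\<phi> / (4 * pi)"
    by (simp add: power_divide)
qed

lemma weak_solutionE:
  assumes "weak_solution e lam \<alpha> f u \<phi>"
  obtains Gu G\<phi> where "H1_grad u Gu" "weak_poisson (\<lambda>x. 4 * pi * e * (u x)\<^sup>2) \<phi> G\<phi>"
    "dirichlet Gu + (\<integral>x. (u x)\<^sup>2 \<partial>lborel) + dirichlet G\<phi> / (4 * pi)
      = lam * (\<integral>x. \<alpha> x * f (u x) * u x \<partial>lborel)"
proof -
  obtain Gu G\<phi> where sol: "H1_grad u Gu" "D12_grad \<phi> G\<phi>"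
    "\<And>v Gv. H1_grad v Gv \<Longrightarrow> (\<integral>x. Gu x \<bullet> Gv x + u x * v x + e * \<phi> x * u x * v x \<partial>lborel)
      = lam * (\<integral>x. \<alpha> x * f (u x) * v x \<partial>lborel)"
    "\<And>\<psi> G\<psi>. D12_grad \<psi> G\<psi> \<Longrightarrow> (\<integral>x. G\<phi> x \<bullet> G\<psi> x \<partial>lborel) = 4 * pi * e * (\<integral>x. (u x)\<^sup>2 * \<psi> x \<partial>lborel)"
    using assms unfolding weak_solution_def by blast
  have "4 * pi * e * (\<integral>x. (u x)\<^sup>2 * \<psi> x \<partial>lborel) = (\<integral>x. 4 * pi * e * (u x)\<^sup>2 * \<psi> x \<partial>lborel)" for \<psi>
    unfolding mult.assoc[of "4 * pi * e"] by (rule integral_mult_right_zero[symmetric])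
  with sol have poisson: "weak_poisson (\<lambda>x. 4 * pi * e * (u x)\<^sup>2) \<phi> G\<phi>"
    by (simp add: weak_poisson_def)
  then show ?thesis
    using sol(1) sol(3)[OF sol(1)] integral_energy_density[OF sol(1) poisson] by (intro that) simp_all
qed

theorem theorem1p1:
  fixes e lam :: real and f :: "real \<Rightarrow> real" and \<alpha> u \<phi> :: "R3 \<Rightarrow> real"
  assumes e_pos: "e > 0"
    and f_cont: "continuous_on UNIV f"
    and f1: "((\<lambda>s. f s / s) \<longlongrightarrow> 0) at_infinity"
    and f2: "((\<lambda>s. f s / s) \<longlongrightarrow> 0) (at 0)"
    and f3: "\<exists>s0::real. (LBINT t=ereal 0..ereal s0. f t) > 0"
    and alpha: "Linf \<alpha>"
    and lam: "0 \<le> lam" "lam * norm_inf \<alpha> * c_f e f < 1"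
    and sol: "weak_solution e lam \<alpha> f u \<phi>"
  shows "AE x in lborel. u x = 0 \<and> \<phi> x = 0"
proof -
  obtain Gu G\<phi> where u: "H1_grad u Gu" and \<phi>: "weak_poisson (\<lambda>x. 4 * pi * e * (u x)\<^sup>2) \<phi> G\<phi>"
    and energy: "dirichlet Gu + (\<integral>x. (u x)\<^sup>2 \<partial>lborel) + dirichlet G\<phi> / (4 * pi)
      = lam * (\<integral>x. \<alpha> x * f (u x) * u x \<partial>lborel)"
    using sol by (rule weak_solutionE)
  define T where "T = (\<integral>x. (u x)\<^sup>2 \<partial>lborel) + 4 * sqrt pi * e * (\<integral>x. \<bar>u x\<bar> ^ 3 \<partial>lborel)"
  let ?E = "dirichlet Gu + (\<integral>x. (u x)\<^sup>2 \<partial>lborel) + dirichlet G\<phi> / (4 * pi)"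
  have "(\<integral>x. \<alpha> x * f (u x) * u x \<partial>lborel) \<le> norm_inf \<alpha> * c_f e f * T"
    unfolding T_def
    by (intro integral_nonlinearity_le e_pos borel_measurable_continuous_onI f_cont bdd_above_c_f f1 f2 alpha
        weak_gradD(1)[OF H1_gradD(1)[OF u]] H1_gradD(2)[OF u] poisson_integrable_cubic[OF e_pos u \<phi>])
  then have E_le: "?E \<le> (lam * norm_inf \<alpha> * c_f e f) * T"
    unfolding energy using mult_left_mono[OF _ lam(1)] by (simp add: mult.assoc)
  moreover have T: "0 \<le> T" "T \<le> ?E"
    using poisson_cubic_le[OF e_pos u \<phi>] e_pos by (simp_all add: T_def)
  ultimately have "(1 - lam * norm_inf \<alpha> * c_f e f) * T \<le> 0"
    by (simp add: left_diff_distrib)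
  with T(1) lam(2) have "T = 0"
    by (simp add: mult_le_0_iff)
  moreover have "0 \<le> dirichlet Gu" "0 \<le> (\<integral>x. (u x)\<^sup>2 \<partial>lborel)" "0 \<le> dirichlet G\<phi> / (4 * pi)"
    by simp_all
  ultimately have "(\<integral>x. (u x)\<^sup>2 \<partial>lborel) = 0 \<and> dirichlet G\<phi> / (4 * pi) = 0"
    using E_le by (simp only: mult_zero_right) linarith
  then have "AE x in lborel. (u x)\<^sup>2 = 0" "AE x in lborel. \<phi> x = 0"
    using integral_nonneg_eq_0_iff_AE[OF H1_gradD(2)[OF u]] D12_grad_eq_0[OF weak_poissonD(1)[OF \<phi>]]
    by simp_all
  then show ?thesis by auto
qed

end
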